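(* Let $\mathbf{X}=(\mathbf{x}_1,\ldots,\mathbf{x}_n)'\in\mathbb{R}^{n\times p}$ and let $y_1,\ldots,y_n$ be independent, where the conditional distribution of $y_i$ given $\mathbf{x}_i$ ($i=1,\ldots,n$) is Bernoulli with $\Pr(y_i=1\mid\mathbf{x}_i,\beta^\star)=\exp(\mathbf{x}_i'\beta^\star)/(1+\exp(\mathbf{x}_i'\beta^\star))$. Let $\mathcal{A}=\{j:\beta^\star_j\ne0\}$, $s=|\mathcal{A}|$, let $P_\lambda$ be a folded concave penalty with constants $a_1,a_2,a$, and let $a_0=\min\{1,a_2\}$. Consider the penalized logistic regression $$\min_\beta\frac1n\sum_i\{-y_i\mathbf{x}_i'\beta+\psi(\mathbf{x}_i'\beta)\}+\sum_jP_\lambda(|\beta_j|),\qquad\psi(t)=\log(1+\exp(t)).$$ Let $\delta_0=\Pr(\|\hat\beta^{\mathrm{initial}}-\beta^\star\|_{\max}>a_0\lambda)$. Then the LLA algorithm initialized by $\hat\beta^{\mathrm{initial}}$ converges to $\hat\beta^{\mathrm{oracle}}$ after two iterations with probability at least $1-\delta_0-\delta_1^{\mathrm{logit}}-\delta_2^{\mathrm{logit}}$, where $$\delta_1^{\mathrm{logit}}=2s\exp\left(-\frac nM\min\left\{\frac{2}{Q_1^2Q_2^4s^2},\frac{a_1^2\lambda^2}{2(1+2Q_3)^2}\right\}\right)+2(p-s)\exp\left(-\frac{a_1^2n\lambda^2}{2M}\right)$$ with $M=\max_jn^{-1}\|\mathbf{x}_{(j)}\|_{\ell_2}^2$, and 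$$\delta_2^{\mathrm{logit}}=2s\exp\left(-\frac{n}{MQ_2^2}\min\left\{\frac{2}{Q_1^2Q_2^2s^2},\frac12\left(\|\beta^\star_{\mathcal{A}}\|_{\min}-a\lambda\right)^2\right\}\right).$$
   Context: $\mathbf{x}_{(j)}=(x_{1j},\ldots,x_{nj})'$ is the $j$th column of $\mathbf{X}$; $\mathbf{X}_{\mathcal{A}}$, $\mathbf{X}_{\mathcal{A}^c}$ are the submatrices of columns in $\mathcal{A}$, $\mathcal{A}^c$. $\|v\|_{\max}=\max_j|v_j|$, $\|v\|_{\min}=\min_j|v_j|$; for a matrix $\mathbf{U}$, $\|\mathbf{U}\|_{\ell_\infty}=\max_i\sum_j|u_{ij}|$ and $\lambda_{\max}(\mathbf{U})$ is the largest eigenvalue. Let $\Sigma(\beta)=\mathrm{diag}\{\psi''(\mathbf{x}_1'\beta),\ldots,\psi''(\mathbf{x}_n'\beta)\}$ and $$Q_1=\max_{j}\lambda_{\max}\left(\tfrac1n\mathbf{X}_{\mathcal{A}}'\,\mathrm{diag}\{|\mathbf{x}_{(j)}|\}\,\mathbf{X}_{\mathcal{A}}\right),\quad Q_2=\left\|\left(\tfrac1n\mathbf{X}_{\mathcal{A}}'\Sigma(\beta^\star)\mathbf{X}_{\mathcal{A}}\right)^{-1}\right\|_{\ell_\infty},$$ $$Q_3=\left\|\mathbf{X}_{\mathcal{A}^c}'\Sigma(\beta^\star)\mathbf{X}_{\mathcal{A}}\left(\mathbf{X}_{\mathcal{A}}'\Sigma(\beta^\star)\mathbf{X}_{\mathcal{A}}\right)^{-1}\right\|_{\ell_\infty},$$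 where $\mathrm{diag}\{|\mathbf{x}_{(j)}|\}$ is the diagonal matrix with entries $|x_{1j}|,\ldots,|x_{nj}|$. Folded concave penalty: $P_\lambda(|t|)$, $t\in\mathbb{R}$, where, for fixed constants $a_1,a_2>0$ and $a>a_2$: (i) $P_\lambda(t)$ is increasing and concave on $[0,\infty)$ with $P_\lambda(0)=0$; (ii) $P_\lambda$ is differentiable on $(0,\infty)$ with $P'_\lambda(0):=P'_\lambda(0+)\ge a_1\lambda$; (iii) $P'_\lambda(t)\ge a_1\lambda$ for $t\in(0,a_2\lambda]$; (iv) $P'_\lambda(t)=0$ for $t\in[a\lambda,\infty)$. Oracle estimator: with $\ell_n(\beta)=\frac1n\sum_i\{-y_i\mathbf{x}_i'\beta+\psi(\mathbf{x}_i'\beta)\}$, $\hat\beta^{\mathrm{oracle}}=(\hat\beta^{\mathrm{oracle}}_{\mathcal{A}},0)=\arg\min_{\beta:\beta_{\mathcal{A}^c}=0}\ell_n(\beta)$. Standing assumption: this problem is regular, so that the oracle solution is unique and $\nabla_j\ell_n(\hat\beta^{\mathrm{oracle}})=0$ for all $j\in\mathcal{A}$. LLA (local linear approximation) algorithm: set $\hat\beta^{(0)}=\hat\beta^{\mathrm{initial}}$ (a given initial estimator); for $m=1,2,\ldots$ let $\hat\beta^{(m)}=\arg\min_\beta\ \ell_n(\beta)+\sum_jP'_\lambda(|\hat\beta^{(m-1)}_j|)\,|\beta_j|$. "Converges to $\hat\beta^{\mathrm{oracle}}$ after two iterations" means that the first iteration finds $\hat\beta^{\mathrm{oracle}}$ and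 the second returns it again: $\hat\beta^{(1)}=\hat\beta^{(2)}=\hat\beta^{\mathrm{oracle}}$.
   Formalization: The formal theorem adds the minimal-signal condition min_{j in A}|β*_j| > (a+1)λ, without which the claim fails (e.g. p=1, x_i=1, 0<β*<a_2λ, initial estimator β*, n large); existence and regularity of the oracle are proved on the event, not assumed. *)

theory Defs
  imports "HOL-Probability.Probability"
begin

definition support :: "real ^ 'p \<Rightarrow> 'p set" where
  "support b = {j. b $ j \<noteq> 0}"

definition min_norm_on :: "'p set \<Rightarrow> real ^ 'p \<Rightarrow> real" where
  "min_norm_on A b = Min ((\<lambda>j. \<bar>b $ j\<bar>) ` A)"


text \<open>Submatrices indexed by a set \<open>A\<close> of coordinates are stored in matrices over the full
  index type whose entries outside the block are zero.  Products, transposes and maximal row sums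
  of such zero-padded matrices are those of the blocks; for eigenvalues and inverses the block
  has to be named explicitly.\<close>

definition col_sub :: "'p set \<Rightarrow> real ^ 'p ^ 'n \<Rightarrow> real ^ 'p ^ 'n" where
  "col_sub A X = (\<chi> i j. if j \<in> A then X $ i $ j else 0)"

definition diag_mat :: "('n \<Rightarrow> real) \<Rightarrow> real ^ 'n ^ 'n" where
  "diag_mat d = (\<chi> i k. if i = k then d i else 0)"

definition linf_norm :: "real ^ 'p ^ 'n::finite \<Rightarrow> real" where
  "linf_norm U = Max (range (\<lambda>i. \<Sum>j\<in>UNIV. \<bar>U $ i $ j\<bar>))"

text \<open>Eigenvectors supported on \<open>A\<close> are the eigenvectors of the \<open>A \<times> A\<close> block, so that the zero
  padding contributes no eigenvalue.\<close>

definition lambda_max_on :: "'p set \<Rightarrow> real ^ 'p ^ 'p \<Rightarrow> real" where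
  "lambda_max_on A U = Max {\<mu>. \<exists>v. v \<noteq> 0 \<and> (\<forall>j. j \<notin> A \<longrightarrow> v $ j = 0) \<and> U *v v = \<mu> *\<^sub>R v}"

definition is_inverse_on :: "'p set \<Rightarrow> real ^ 'p ^ 'p \<Rightarrow> real ^ 'p ^ 'p \<Rightarrow> bool" where
  "is_inverse_on A U V \<longleftrightarrow>
     (\<forall>i j. i \<notin> A \<or> j \<notin> A \<longrightarrow> V $ i $ j = 0) \<and>
     U ** V = diag_mat (indicator A) \<and> V ** U = diag_mat (indicator A)"

definition invertible_on :: "'p set \<Rightarrow> real ^ 'p ^ 'p \<Rightarrow> bool" where
  "invertible_on A U \<longleftrightarrow> (\<exists>V. is_inverse_on A U V)"

definition matrix_inv_on :: "'p set \<Rightarrow> real ^ 'p ^ 'p \<Rightarrow> real ^ 'p ^ 'p" where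
  "matrix_inv_on A U = (THE V. is_inverse_on A U V)"


definition psi :: "real \<Rightarrow> real" where
  "psi t = ln (1 + exp t)"

definition Sigma_mat :: "real ^ 'p ^ 'n \<Rightarrow> real ^ 'p \<Rightarrow> real ^ 'n ^ 'n" where
  "Sigma_mat X b = diag_mat (\<lambda>i. deriv (deriv psi) (row i X \<bullet> b))"

definition Q1 :: "real ^ 'p ^ 'n \<Rightarrow> 'p set \<Rightarrow> real" where
  "Q1 X A = Max (range (\<lambda>j. lambda_max_on A
     ((1 / real CARD('n)) *\<^sub>R
        (transpose (col_sub A X) ** diag_mat (\<lambda>i. \<bar>column j X $ i\<bar>) ** col_sub A X))))"

definition Q2 :: "real ^ 'p ^ 'n \<Rightarrow> 'p set \<Rightarrow> real ^ 'p \<Rightarrow> real" where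
  "Q2 X A b = linf_norm (matrix_inv_on A
     ((1 / real CARD('n)) *\<^sub>R (transpose (col_sub A X) ** Sigma_mat X b ** col_sub A X)))"

definition Q3 :: "real ^ 'p ^ 'n \<Rightarrow> 'p set \<Rightarrow> real ^ 'p \<Rightarrow> real" where
  "Q3 X A b = linf_norm
     (transpose (col_sub (- A) X) ** Sigma_mat X b ** col_sub A X **
      matrix_inv_on A (transpose (col_sub A X) ** Sigma_mat X b ** col_sub A X))"


text \<open>Derivative on \<open>[0, \<infinity>)\<close>, with the convention \<open>P'(0) = P'(0+)\<close>.\<close>

definition pen_deriv :: "(real \<Rightarrow> real) \<Rightarrow> real \<Rightarrow> real" where
  "pen_deriv P t = (if t = 0 then Lim (at_right 0) (deriv P) else deriv P t)"

text \<open>\<open>P\<close> is the penalty for one value \<open>lam\<close> of the regularization parameter.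
  Existence of the (finite) limit \<open>P'(0+)\<close> is required so that \<open>P'(0)\<close> is a real number.\<close>

definition folded_concave :: "real \<Rightarrow> real \<Rightarrow> real \<Rightarrow> real \<Rightarrow> (real \<Rightarrow> real) \<Rightarrow> bool" where
  "folded_concave a1 a2 a lam P \<longleftrightarrow>
     0 < a1 \<and> 0 < a2 \<and> a2 < a \<and>
     mono_on {0..} P \<and> concave_on {0..} P \<and> P 0 = 0 \<and>
     (\<forall>t>0. P differentiable (at t)) \<and>
     (\<exists>d. (deriv P \<longlongrightarrow> d) (at_right 0)) \<and> a1 * lam \<le> pen_deriv P 0 \<and>
     (\<forall>t\<in>{0<..a2 * lam}. a1 * lam \<le> pen_deriv P t) \<and>
     (\<forall>t\<in>{a * lam..}. pen_deriv P t = 0)"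


text \<open>Negative log-likelihood; the responses are Booleans, coded as 0 and 1.\<close>

definition logit_loss :: "real ^ 'p ^ 'n \<Rightarrow> ('n \<Rightarrow> bool) \<Rightarrow> real ^ 'p \<Rightarrow> real" where
  "logit_loss X y b =
     (1 / real CARD('n)) * (\<Sum>i\<in>UNIV. - of_bool (y i) * (row i X \<bullet> b) + psi (row i X \<bullet> b))"

definition partial_deriv :: "(real ^ 'p \<Rightarrow> real) \<Rightarrow> 'p \<Rightarrow> real ^ 'p \<Rightarrow> real" where
  "partial_deriv f j b = deriv (\<lambda>t. f (b + t *\<^sub>R axis j 1)) 0"

definition is_unique_arg_min :: "('a \<Rightarrow> real) \<Rightarrow> ('a \<Rightarrow> bool) \<Rightarrow> 'a \<Rightarrow> bool" where
  "is_unique_arg_min f S b \<longleftrightarrow> is_arg_min f S b \<and> (\<forall>c. is_arg_min f S c \<longrightarrow> c = b)"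

text \<open>\<open>b\<close> is the oracle estimator and the oracle problem is regular.  Regularity is a property of
  the responses: if they are separable, the oracle problem has no minimizer, and this happens with
  positive probability.\<close>

definition regular_oracle :: "real ^ 'p ^ 'n \<Rightarrow> 'p set \<Rightarrow> ('n \<Rightarrow> bool) \<Rightarrow> real ^ 'p \<Rightarrow> bool" where
  "regular_oracle X A y b \<longleftrightarrow>
     is_unique_arg_min (logit_loss X y) (\<lambda>b. \<forall>j. j \<notin> A \<longrightarrow> b $ j = 0) b \<and>
     (\<forall>j\<in>A. partial_deriv (logit_loss X y) j b = 0)"

definition lla_objective ::
  "real ^ 'p ^ 'n \<Rightarrow> ('n \<Rightarrow> bool) \<Rightarrow> (real \<Rightarrow> real) \<Rightarrow> real ^ 'p \<Rightarrow> real ^ 'p \<Rightarrow> real" where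
  "lla_objective X y P b0 b = logit_loss X y b + (\<Sum>j\<in>UNIV. pen_deriv P \<bar>b0 $ j\<bar> * \<bar>b $ j\<bar>)"

definition lla_sequence ::
  "real ^ 'p ^ 'n \<Rightarrow> ('n \<Rightarrow> bool) \<Rightarrow> (real \<Rightarrow> real) \<Rightarrow> real ^ 'p \<Rightarrow> (nat \<Rightarrow> real ^ 'p) \<Rightarrow> bool" where
  "lla_sequence X y P b0 b \<longleftrightarrow>
     b 0 = b0 \<and>
     (\<forall>m. is_unique_arg_min (lla_objective X y P (b m)) (\<lambda>_. True) (b (Suc m)))"

definition lla_converges_to_oracle ::
  "real ^ 'p ^ 'n \<Rightarrow> 'p set \<Rightarrow> ('n \<Rightarrow> bool) \<Rightarrow> (real \<Rightarrow> real) \<Rightarrow> real ^ 'p \<Rightarrow> bool" where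
  "lla_converges_to_oracle X A y P b0 \<longleftrightarrow>
     (\<exists>b_oracle b. regular_oracle X A y b_oracle \<and> lla_sequence X y P b0 b \<and>
        b 1 = b_oracle \<and> b 2 = b_oracle)"

end

theory Submission
  imports Defs
begin

text \<open>The proof separates a deterministic part from a concentration bound.  Let \<open>G\<close> be the gradient
  of the loss at \<open>\<beta>\<^sup>*\<close>, with \<open>\<bar>G\<^sub>j\<bar> \<le> g\<close> on \<open>A\<close>.  The gradient at \<open>\<beta>\<^sup>* + \<Delta>\<close> is \<open>G + H \<Delta> + R(\<Delta>)\<close>, and since
  \<open>\<bar>\<psi>'''\<bar> \<le> 1/2\<close> the remainder is at most \<open>Q\<^sub>1 s r\<^sup>2 / 4\<close> on the box \<open>\<bar>\<Delta>\<^sub>j\<bar> \<le> r\<close>.  With \<open>r = 2 Q\<^sub>2 g\<close> and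
  \<open>Q\<^sub>1 Q\<^sub>2\<^sup>2 s g \<le> 1\<close> this is at most \<open>g\<close>, so that the map \<open>\<Delta> \<mapsto> \<Delta> - H\<^sup>-\<^sup>1 \<nabla>(\<beta>\<^sup>* + \<Delta>)\<close> sends the box to
  itself; its Brouwer fixed point is the oracle estimator, which therefore lies within \<open>2 Q\<^sub>2 g\<close> of \<open>\<beta>\<^sup>*\<close>,
  and off \<open>A\<close> its gradient is at most \<open>\<bar>G\<^sub>j\<bar> + (1 + 2 Q\<^sub>3) g\<close>.  If that is below \<open>a\<^sub>1 \<lambda>\<close>, the convexity of
  the loss makes the oracle the unique minimizer of every weighted lasso problem whose weights vanish
  on \<open>A\<close> and are at least \<open>a\<^sub>1 \<lambda>\<close> off \<open>A\<close>, which is what both LLA steps solve.  Hoeffding's inequality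
  bounds the coordinates of \<open>G\<close>.\<close>

section \<open>The logistic function\<close>

definition sigm :: "real \<Rightarrow> real" where
  "sigm t = exp t / (1 + exp t)"

lemma one_plus_exp_pos [simp]: "0 < 1 + exp (t :: real)"
  by (simp add: add_pos_pos)

lemma one_plus_exp_neq_0 [simp]: "1 + exp t \<noteq> (0 :: real)"
  using one_plus_exp_pos[of t] by linarith

lemma sigm_bounds: "0 < sigm t" "sigm t < 1"
  by (auto simp: sigm_def divide_simps add_pos_pos)

lemma psi_has_deriv: "(psi has_real_derivative sigm t) (at t)"
  unfolding psi_def sigm_def
  by (rule derivative_eq_intros refl add_pos_pos zero_less_one exp_gt_zero)+ simp

lemma sigm_has_deriv: "(sigm has_real_derivative sigm t * (1 - sigm t)) (at t)"
proof -
  have "((\<lambda>t. exp t / (1 + exp t)) has_real_derivative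
      (exp t * (1 + exp t) - exp t * exp t) / ((1 + exp t) * (1 + exp t))) (at t)"
    by (rule derivative_eq_intros refl | simp)+
  also have "(exp t * (1 + exp t) - exp t * exp t) / ((1 + exp t) * (1 + exp t)) =
      sigm t * (1 - sigm t)"
    by (simp add: sigm_def field_simps)
  finally show ?thesis
    by (simp add: sigm_def[abs_def])
qed

lemma deriv_psi: "deriv psi = sigm"
  using psi_has_deriv by (auto intro!: DERIV_imp_deriv)

lemma deriv_sigm: "deriv sigm t = sigm t * (1 - sigm t)"
  using sigm_has_deriv by (rule DERIV_imp_deriv)

lemma sigm_strict_mono: "s < t \<Longrightarrow> sigm s < sigm t"
  by (simp add: sigm_def divide_less_eq less_divide_eq) (simp add: field_simps)

lemma continuous_on_sigm [continuous_intros]: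
  "continuous_on S f \<Longrightarrow> continuous_on S (\<lambda>x. sigm (f x))"
  unfolding sigm_def by (intro continuous_intros) auto

lemma continuous_on_psi [continuous_intros]:
  "continuous_on S f \<Longrightarrow> continuous_on S (\<lambda>x. psi (f x))"
  unfolding psi_def by (intro continuous_intros) (auto simp: add_pos_pos add_nonneg_eq_0_iff)

text \<open>Second-order Taylor expansion: with \<open>s = sigm z\<close>, the second derivative
  \<open>s (1 - s) (1 - 2 s)\<close> is at most 1/4 in absolute value. This would give 1/8; the
  cruder 1/4 already fits the constants of the final bound.\<close>

lemma sigm_taylor: "\<bar>sigm (u + t) - sigm u - sigm u * (1 - sigm u) * t\<bar> \<le> t\<^sup>2 / 4"
proof (cases "t = 0")
  case False
  define d :: "nat \<Rightarrow> real \<Rightarrow> real" where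
    "d m = (if m = 0 then sigm else if m = 1 then (\<lambda>x. sigm x * (1 - sigm x))
            else (\<lambda>x. sigm x * (1 - sigm x) * (1 - 2 * sigm x)))" for m
  have "((\<lambda>x. sigm x * (1 - sigm x)) has_real_derivative
      sigm x * (1 - sigm x) * (1 - 2 * sigm x)) (at x)" for x
    by (rule derivative_eq_intros refl sigm_has_deriv)+ (simp add: algebra_simps)
  then have "\<forall>m x. m < 2 \<and> min u (u + t) \<le> x \<and> x \<le> max u (u + t) \<longrightarrow>
      (d m has_real_derivative d (Suc m) x) (at x)"
    by (auto simp: d_def sigm_has_deriv less_2_cases_iff)
  then obtain z where z: "sigm (u + t) =
      (\<Sum>m<2. (d m u / fact m) * (u + t - u) ^ m) + (d 2 z / fact 2) * (u + t - u) ^ 2"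
    using Taylor[of 2 d sigm "min u (u + t)" "max u (u + t)" u "u + t"] False
    by (auto simp: d_def)
  have "\<bar>sigm z * (1 - sigm z)\<bar> \<le> 1 / 4"
    using sigm_bounds[of z] zero_le_power2[of "sigm z - 1 / 2"]
    by (simp add: power2_eq_square algebra_simps abs_mult)
  moreover have "\<bar>1 - 2 * sigm z\<bar> \<le> 1"
    using sigm_bounds[of z] by auto
  ultimately have "\<bar>sigm z * (1 - sigm z)\<bar> * \<bar>1 - 2 * sigm z\<bar> \<le> 1 / 4 * 1"
    by (intro mult_mono) auto
  then have "\<bar>d 2 z / 2\<bar> \<le> 1 / 4"
    by (simp add: d_def abs_mult)
  then have "\<bar>d 2 z / 2 * t\<^sup>2\<bar> \<le> 1 / 4 * t\<^sup>2"
    unfolding abs_mult by (intro mult_mono) auto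
  moreover have eq: "sigm (u + t) - sigm u - sigm u * (1 - sigm u) * t = d 2 z / 2 * t\<^sup>2"
    using z by (simp add: numeral_2_eq_2 d_def)
  ultimately show ?thesis unfolding eq by linarith
qed simp

text \<open>By the mean value theorem the slope of a chord is \<open>sigm\<close> at an interior
  point, and \<open>sigm\<close> is strictly increasing.\<close>

lemma psi_tangent_less:
  assumes "t \<noteq> u"
  shows "psi u + sigm u * (t - u) < psi t"
proof (cases "u < t")
  case True
  then obtain z where "u < z" "z < t" "psi t - psi u = (t - u) * sigm z"
    using MVT2[of u t psi sigm] psi_has_deriv by blast
  then show ?thesis
    using sigm_strict_mono[of u z] True mult_strict_left_mono[of "sigm u" "sigm z" "t - u"]
    by (simp add: algebra_simps)
next
  case False
  with assms have "t < u" by simp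
  then obtain z where "t < z" "z < u" "psi u - psi t = (u - t) * sigm z"
    using MVT2[of t u psi sigm] psi_has_deriv by blast
  then show ?thesis
    using sigm_strict_mono[of z u] \<open>t < u\<close> mult_strict_left_mono[of "sigm z" "sigm u" "u - t"]
    by (simp add: algebra_simps)
qed

lemma psi_tangent_le: "psi u + sigm u * (t - u) \<le> psi t"
  using psi_tangent_less[of t u] by (cases "t = u") auto

section \<open>Eigenvalues of symmetric matrices\<close>

lemma inner_matrix_vector_symmetric:
  fixes U :: "real ^ 'n ^ 'n"
  assumes "transpose U = U"
  shows "(U *v v) \<bullet> w = v \<bullet> (U *v w)"
  using dot_lmul_matrix[of v U w] transpose_matrix_vector[of U v] assms by simp

text \<open>Eigenvectors for distinct eigenvalues of a symmetric matrix are orthogonal, hence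
  independent, so there are finitely many. Finiteness makes the \<open>Max\<close> in
  \<open>lambda_max_on\<close> meaningful.\<close>

lemma finite_eigenvalues_symmetric:
  fixes U :: "real ^ 'n ^ 'n"
  assumes "transpose U = U"
  shows "finite {\<mu>. \<exists>v. v \<noteq> 0 \<and> U *v v = \<mu> *\<^sub>R v}" (is "finite ?E")
proof -
  define e where "e \<mu> = (SOME v. v \<noteq> 0 \<and> U *v v = \<mu> *\<^sub>R v)" for \<mu>
  have e: "e \<mu> \<noteq> 0 \<and> U *v e \<mu> = \<mu> *\<^sub>R e \<mu>" if "\<mu> \<in> ?E" for \<mu>
    using someI_ex[of "\<lambda>v. v \<noteq> 0 \<and> U *v v = \<mu> *\<^sub>R v"] that by (simp add: e_def)
  have orth: "e \<mu> \<bullet> e \<nu> = 0" if "\<mu> \<in> ?E" "\<nu> \<in> ?E" "\<mu> \<noteq> \<nu>" for \<mu> \<nu>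
  proof -
    have "\<mu> * (e \<mu> \<bullet> e \<nu>) = (U *v e \<mu>) \<bullet> e \<nu>"
      using e that by simp
    also have "\<dots> = e \<mu> \<bullet> (U *v e \<nu>)"
      by (rule inner_matrix_vector_symmetric[OF assms])
    also have "\<dots> = \<nu> * (e \<mu> \<bullet> e \<nu>)"
      using e that by simp
    finally show ?thesis using that by simp
  qed
  have "inj_on e ?E"
  proof (rule inj_onI, rule ccontr)
    fix \<mu> \<nu> assume *: "\<mu> \<in> ?E" "\<nu> \<in> ?E" "e \<mu> = e \<nu>" "\<mu> \<noteq> \<nu>"
    then have "e \<nu> \<bullet> e \<nu> = 0" using orth[of \<mu> \<nu>] by simp
    then show False using e[of \<nu>] * by simp
  qed
  have "pairwise orthogonal (e ` ?E)"
    using orth by (auto simp: pairwise_def orthogonal_def)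
  moreover have "0 \<notin> e ` ?E"
  proof
    assume "0 \<in> e ` ?E"
    then obtain \<mu> where "\<mu> \<in> ?E" "0 = e \<mu>" by (rule imageE) blast
    with e[of \<mu>] show False by simp
  qed
  ultimately have "independent (e ` ?E)"
    by (rule pairwise_orthogonal_independent)
  then have "finite (e ` ?E)"
    by (rule independent_imp_finite)
  then show ?thesis
    using \<open>inj_on e ?E\<close> by (rule finite_imageD)
qed

text \<open>Rayleigh's principle on the coordinate subspace of \<open>A\<close>: the form attains
  its maximum on the unit sphere, and the maximizer is an eigenvector. The assumption
  \<open>block\<close> keeps \<open>U\<close> inside the subspace.\<close>

lemma quadratic_form_le_lambda_max_on:
  fixes U :: "real ^ 'p ^ 'p"
  assumes sym: "transpose U = U"
    and block: "\<And>v j. j \<notin> A \<Longrightarrow> (U *v v) $ j = 0"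
    and v: "\<And>j. j \<notin> A \<Longrightarrow> v $ j = 0"
    and "A \<noteq> {}"
  shows "v \<bullet> (U *v v) \<le> lambda_max_on A U * (norm v)\<^sup>2"
proof -
  define V where "V = {v :: real ^ 'p. \<forall>j. j \<notin> A \<longrightarrow> v $ j = 0}"
  have "closed V"
    unfolding V_def by (intro closed_Collect_all closed_Collect_imp closed_Collect_eq
        continuous_intros open_Collect_const)
  then have c: "compact (V \<inter> sphere 0 1)"
    by (intro closed_Int_compact compact_sphere)
  obtain i where "i \<in> A" using \<open>A \<noteq> {}\<close> by auto
  then have "axis i 1 \<in> V \<inter> sphere 0 1"
    by (auto simp: V_def axis_def norm_axis_1[unfolded axis_def])
  then have ne: "V \<inter> sphere 0 1 \<noteq> {}" by blast
  have "continuous_on (V \<inter> sphere 0 1) (\<lambda>v. v \<bullet> (U *v v))"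
    by (intro continuous_intros)
  from continuous_attains_sup[OF c ne this] obtain v0 where v0: "v0 \<in> V \<inter> sphere 0 1"
    and max: "\<And>v. v \<in> V \<inter> sphere 0 1 \<Longrightarrow> v \<bullet> (U *v v) \<le> v0 \<bullet> (U *v v0)"
    by blast
  define \<mu> where "\<mu> = v0 \<bullet> (U *v v0)"
  have le: "v \<bullet> (U *v v) \<le> \<mu> * (norm v)\<^sup>2" if "v \<in> V" for v
  proof (cases "v = 0")
    case False
    then have "(1 / norm v) *\<^sub>R v \<in> V \<inter> sphere 0 1"
      using that by (auto simp: V_def)
    from max[OF this] have "v \<bullet> (U *v v) / (norm v)\<^sup>2 \<le> \<mu>"
      by (simp add: \<mu>_def matrix_vector_mult_scaleR power2_eq_square)
    then show ?thesis
      using False by (simp add: divide_le_eq)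
  qed simp
  \<comment> \<open>\<open>w\<close> measures the failure of the eigenvalue equation at the
    maximizer \<open>v0\<close>.\<close>
  define w where "w = \<mu> *\<^sub>R v0 - U *v v0"
  have w: "w \<in> V" using v0 block by (auto simp: w_def V_def)
  have adj: "w \<bullet> (U *v v0) = v0 \<bullet> (U *v w)"
    using inner_matrix_vector_symmetric[OF sym, of v0 w] by (simp add: inner_commute)
  define c where "c = \<mu> * (norm w)\<^sup>2 - w \<bullet> (U *v w)"
  \<comment> \<open>Comparing \<open>v0\<close> with \<open>v0 + t w\<close>: the constant terms
    cancel, and by symmetry of \<open>U\<close> the coefficient of \<open>t\<close> is twice the
    squared norm of \<open>w\<close>.\<close>
  have q: "0 \<le> 2 * t * (norm w)\<^sup>2 + t\<^sup>2 * c" for t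
  proof -
    have "v0 + t *\<^sub>R w \<in> V" using v0 w by (auto simp: V_def)
    from le[OF this] have "(v0 + t *\<^sub>R w) \<bullet> (U *v (v0 + t *\<^sub>R w)) \<le>
        \<mu> * ((v0 + t *\<^sub>R w) \<bullet> (v0 + t *\<^sub>R w))"
      by (simp add: power2_norm_eq_inner)
    moreover have "v0 \<bullet> v0 = 1"
      using v0 by (simp add: dot_square_norm)
    ultimately have "\<mu> + 2 * t * (v0 \<bullet> (U *v w)) + t\<^sup>2 * (w \<bullet> (U *v w)) \<le>
        \<mu> + 2 * t * (\<mu> * (v0 \<bullet> w)) + t\<^sup>2 * (\<mu> * (w \<bullet> w))"
      using adj by (simp add: matrix_vector_mult_scaleR matrix_vector_right_distrib inner_add
          \<mu>_def[symmetric] inner_commute[of w v0] algebra_simps power2_eq_square)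
    moreover have "w \<bullet> w = \<mu> * (v0 \<bullet> w) - v0 \<bullet> (U *v w)"
      unfolding adj[symmetric] by (subst (2) w_def) (simp add: inner_diff_right inner_commute)
    then have "2 * t * (w \<bullet> w) = 2 * t * (\<mu> * (v0 \<bullet> w)) - 2 * t * (v0 \<bullet> (U *v w))"
      by (simp add: right_diff_distrib)
    ultimately show ?thesis
      by (simp add: c_def power2_norm_eq_inner right_diff_distrib)
  qed
  have "norm w = 0"
  proof (rule ccontr)
    assume nz: "norm w \<noteq> 0"
    \<comment> \<open>For this negative \<open>t\<close> the quadratic term is at most half as large
      as the linear one, so their sum would be negative.\<close>
    define t where "t = - (norm w)\<^sup>2 / (1 + \<bar>c\<bar>)"
    have t: "(1 + \<bar>c\<bar>) * t = - (norm w)\<^sup>2" by (simp add: t_def)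
    have "t < 0" using nz by (simp add: t_def divide_neg_pos)
    have "t\<^sup>2 * c \<le> t\<^sup>2 * (1 + \<bar>c\<bar>)" by (intro mult_left_mono) auto
    also have "\<dots> = - t * (norm w)\<^sup>2"
      using t by (simp add: power2_eq_square) (metis mult.assoc mult.commute mult_minus_right)
    finally have "0 \<le> t * (norm w)\<^sup>2" using q[of t] by linarith
    then show False using \<open>t < 0\<close> nz by (simp add: zero_le_mult_iff)
  qed
  then have eig: "U *v v0 = \<mu> *\<^sub>R v0" by (simp add: w_def)
  have "\<mu> \<le> lambda_max_on A U"
    unfolding lambda_max_on_def
  proof (rule Max_ge)
    show "finite {\<mu>. \<exists>v. v \<noteq> 0 \<and> (\<forall>j. j \<notin> A \<longrightarrow> v $ j = 0) \<and> U *v v = \<mu> *\<^sub>R v}"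
      by (rule finite_subset[OF _ finite_eigenvalues_symmetric[OF sym]]) auto
    show "\<mu> \<in> {\<mu>. \<exists>v. v \<noteq> 0 \<and> (\<forall>j. j \<notin> A \<longrightarrow> v $ j = 0) \<and> U *v v = \<mu> *\<^sub>R v}"
      using eig v0 by (auto simp: V_def intro!: exI[of _ v0])
  qed
  then have "\<mu> * (norm v)\<^sup>2 \<le> lambda_max_on A U * (norm v)\<^sup>2"
    by (intro mult_right_mono) auto
  with le[of v] v show ?thesis by (auto simp: V_def)
qed

section \<open>Convexity of the logistic loss\<close>

definition logit_grad :: "real ^ 'p ^ 'n \<Rightarrow> ('n \<Rightarrow> bool) \<Rightarrow> real ^ 'p \<Rightarrow> real ^ 'p" where
  "logit_grad X y b = (\<chi> j. (1 / real CARD('n)) *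
     (\<Sum>i\<in>UNIV. X $ i $ j * (sigm (row i X \<bullet> b) - of_bool (y i))))"

lemma inner_row_axis: "row i X \<bullet> axis j 1 = (X :: real ^ 'p ^ 'n) $ i $ j"
  by (simp add: inner_axis row_def)

lemma inner_row: "row i X \<bullet> d = (\<Sum>j\<in>UNIV. (X :: real ^ 'p ^ 'n) $ i $ j * d $ j)"
  by (simp add: inner_vec_def row_def)

lemma partial_deriv_logit_loss:
  fixes X :: "real ^ 'p ^ 'n"
  shows "partial_deriv (logit_loss X y) j b = logit_grad X y b $ j"
proof -
  have 1: "((\<lambda>t. psi (row i X \<bullet> (b + t *\<^sub>R axis j 1))) has_real_derivative
      sigm (row i X \<bullet> b) * X $ i $ j) (at 0)" for i
  proof -
    have "((\<lambda>t. psi (row i X \<bullet> b + t * X $ i $ j)) has_real_derivative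
        sigm (row i X \<bullet> b + 0 * X $ i $ j) * X $ i $ j) (at 0)"
      by (rule DERIV_chain2[OF psi_has_deriv]) (auto intro!: derivative_eq_intros)
    then show ?thesis by (simp add: inner_add_right inner_row_axis)
  qed
  have "((\<lambda>t. logit_loss X y (b + t *\<^sub>R axis j 1)) has_real_derivative
      (1 / real CARD('n)) * (\<Sum>i\<in>UNIV. - of_bool (y i) * X $ i $ j + sigm (row i X \<bullet> b) * X $ i $ j)) (at 0)"
    unfolding logit_loss_def
    by (intro DERIV_cmult DERIV_sum DERIV_add 1)
      (auto simp: inner_add_right inner_row_axis intro!: derivative_eq_intros)
  then show ?thesis
    unfolding partial_deriv_def
    by (auto intro!: DERIV_imp_deriv simp: logit_grad_def algebra_simps)
qed

lemma logit_grad_inner: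
  fixes X :: "real ^ 'p ^ 'n"
  shows "logit_grad X y b \<bullet> d =
    (1 / real CARD('n)) * (\<Sum>i\<in>UNIV. (sigm (row i X \<bullet> b) - of_bool (y i)) * (row i X \<bullet> d))"
proof -
  have "logit_grad X y b \<bullet> d = (1 / real CARD('n)) *
      (\<Sum>j\<in>UNIV. \<Sum>i\<in>UNIV. X $ i $ j * (sigm (row i X \<bullet> b) - of_bool (y i)) * d $ j)"
    by (simp add: inner_vec_def logit_grad_def sum_distrib_left sum_distrib_right mult.assoc)
  also have "\<dots> = (1 / real CARD('n)) *
      (\<Sum>i\<in>UNIV. \<Sum>j\<in>UNIV. X $ i $ j * (sigm (row i X \<bullet> b) - of_bool (y i)) * d $ j)"
    by (subst sum.swap) (rule refl)
  also have "\<dots> = (1 / real CARD('n)) *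
      (\<Sum>i\<in>UNIV. (sigm (row i X \<bullet> b) - of_bool (y i)) * (row i X \<bullet> d))"
    unfolding inner_row[of _ X d] sum_distrib_left by (simp add: mult_ac)
  finally show ?thesis .
qed

text \<open>The responses enter the loss linearly and cancel in the first-order remainder, which is
  a mean of Bregman divergences of \<open>psi\<close>.\<close>

lemma logit_loss_diff:
  fixes X :: "real ^ 'p ^ 'n"
  shows "logit_loss X y c - (logit_loss X y b + logit_grad X y b \<bullet> (c - b)) =
    (1 / real CARD('n)) * (\<Sum>i\<in>UNIV. psi (row i X \<bullet> c) -
      (psi (row i X \<bullet> b) + sigm (row i X \<bullet> b) * (row i X \<bullet> c - row i X \<bullet> b)))"
  unfolding logit_grad_inner logit_loss_def distrib_left[symmetric] right_diff_distrib[symmetric]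
    sum.distrib[symmetric] sum_subtractf[symmetric]
  by (intro arg_cong2[of _ _ _ _ "(*)"] refl sum.cong) (simp add: inner_diff_right algebra_simps)

lemma logit_loss_tangent_le:
  fixes X :: "real ^ 'p ^ 'n"
  shows "logit_loss X y b + logit_grad X y b \<bullet> (c - b) \<le> logit_loss X y c"
proof -
  have "0 \<le> logit_loss X y c - (logit_loss X y b + logit_grad X y b \<bullet> (c - b))"
    unfolding logit_loss_diff
    by (intro mult_nonneg_nonneg sum_nonneg) (use psi_tangent_le in \<open>auto simp: algebra_simps\<close>)
  then show ?thesis by simp
qed

text \<open>The loss is strictly convex only along directions that \<open>X\<close> does not
  annihilate; one row that separates \<open>c\<close> from \<open>b\<close> is enough.\<close>

lemma logit_loss_tangent_less:
  fixes X :: "real ^ 'p ^ 'n"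
  assumes "row i X \<bullet> c \<noteq> row i X \<bullet> b"
  shows "logit_loss X y b + logit_grad X y b \<bullet> (c - b) < logit_loss X y c"
proof -
  have "0 < (\<Sum>i\<in>UNIV. psi (row i X \<bullet> c) -
      (psi (row i X \<bullet> b) + sigm (row i X \<bullet> b) * (row i X \<bullet> c - row i X \<bullet> b)))"
    by (rule sum_pos2[of _ i]) (use psi_tangent_less[OF assms] in \<open>auto simp: psi_tangent_le\<close>)
  then have "0 < logit_loss X y c - (logit_loss X y b + logit_grad X y b \<bullet> (c - b))"
    unfolding logit_loss_diff by (intro mult_pos_pos) auto
  then show ?thesis by simp
qed

lemma continuous_on_logit_loss [continuous_intros]:
  "continuous_on S f \<Longrightarrow> continuous_on S (\<lambda>x. logit_loss X y (f x))"
  unfolding logit_loss_def by (intro continuous_intros)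

lemma continuous_on_logit_grad [continuous_intros]:
  "continuous_on S f \<Longrightarrow> continuous_on S (\<lambda>x. logit_grad X y (f x))"
  unfolding logit_grad_def by (intro continuous_intros continuous_on_vec_lambda)

section \<open>Zero-padded block matrices\<close>

lemma diag_mat_vector: "(diag_mat d *v v) $ i = d i * v $ i"
  by (simp add: diag_mat_def matrix_vector_mult_def if_distrib if_distribR cong: if_cong)

lemma matrix_mul_diag_mat: "(V ** diag_mat d) $ i $ j = V $ i $ j * d j"
  by (simp add: diag_mat_def matrix_matrix_mult_def if_distrib cong: if_cong)

lemma diag_mat_matrix_mul: "(diag_mat d ** V) $ i $ j = d i * V $ i $ j"
  by (simp add: diag_mat_def matrix_matrix_mult_def if_distrib if_distribR cong: if_cong)

text \<open>As \<open>v\<close> is supported on \<open>A\<close>, the zero padding of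
  \<open>col_sub A X\<close> is invisible and full rows of \<open>X\<close> may be used. The block
  \<open>B\<close> may differ from \<open>A\<close>, as in \<open>Q3\<close>.\<close>

lemma gram_vector:
  fixes X :: "real ^ 'p ^ 'n"
  assumes "\<And>k. k \<notin> A \<Longrightarrow> v $ k = 0"
  shows "((transpose (col_sub B X) ** diag_mat d ** col_sub A X) *v v) $ j =
    (if j \<in> B then \<Sum>i\<in>UNIV. X $ i $ j * d i * (row i X \<bullet> v) else 0)"
proof -
  have "(\<Sum>k\<in>UNIV. (if k \<in> A then X $ i $ k else 0) * v $ k) = row i X \<bullet> v" for i
    unfolding inner_row by (intro sum.cong) (auto simp: assms)
  then have "(col_sub A X *v v) $ i = row i X \<bullet> v" for i
    by (simp add: col_sub_def matrix_vector_mult_def)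
  then show ?thesis
    unfolding matrix_vector_mul_assoc[symmetric]
    by (subst matrix_vector_mult_def)
      (auto simp: diag_mat_vector transpose_def col_sub_def mult.assoc)
qed

lemma gram_vector_outside:
  fixes X :: "real ^ 'p ^ 'n"
  assumes "j \<notin> B"
  shows "((transpose (col_sub B X) ** diag_mat d ** col_sub A X) *v v) $ j = 0"
  unfolding matrix_vector_mul_assoc[symmetric]
  by (subst matrix_vector_mult_def) (auto simp: transpose_def col_sub_def assms)

lemma transpose_gram:
  "transpose (transpose C ** diag_mat d ** C) = transpose C ** diag_mat d ** (C :: real ^ 'p ^ 'n)"
proof -
  have "transpose (diag_mat d) = (diag_mat d :: real ^ 'n ^ 'n)"
    by (auto simp: diag_mat_def transpose_def vec_eq_iff)
  then show ?thesis
    by (simp add: matrix_transpose_mul matrix_mul_assoc)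
qed

lemma gram_quadratic_form:
  fixes X :: "real ^ 'p ^ 'n"
  assumes "\<And>k. k \<notin> A \<Longrightarrow> v $ k = 0"
  shows "v \<bullet> ((transpose (col_sub A X) ** diag_mat d ** col_sub A X) *v v) =
    (\<Sum>i\<in>UNIV. d i * (row i X \<bullet> v)\<^sup>2)"
proof -
  have "v \<bullet> ((transpose (col_sub A X) ** diag_mat d ** col_sub A X) *v v) =
      (\<Sum>j\<in>UNIV. v $ j * (\<Sum>i\<in>UNIV. X $ i $ j * d i * (row i X \<bullet> v)))"
    by (subst inner_vec_def) (auto simp: gram_vector[OF assms] assms intro!: sum.cong)
  also have "\<dots> = (\<Sum>i\<in>UNIV. \<Sum>j\<in>UNIV. v $ j * (X $ i $ j * d i * (row i X \<bullet> v)))"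
    unfolding sum_distrib_left by (rule sum.swap)
  also have "\<dots> = (\<Sum>i\<in>UNIV. d i * (row i X \<bullet> v) * (\<Sum>j\<in>UNIV. X $ i $ j * v $ j))"
    unfolding sum_distrib_left by (intro sum.cong) (auto simp: mult_ac)
  finally show ?thesis
    by (simp add: inner_row[symmetric] power2_eq_square mult.assoc)
qed

text \<open>This is how \<open>Q1\<close> enters: the Taylor remainder of the gradient in coordinate
  \<open>j\<close> is controlled by squares weighted with the absolute values of column
  \<open>j\<close>, which form a quadratic form of the matrix inside \<open>Q1\<close>.\<close>

lemma gram_le_Q1:
  fixes X :: "real ^ 'p ^ 'n"
  assumes "A \<noteq> {}" and v: "\<And>k. k \<notin> A \<Longrightarrow> v $ k = 0"
  shows "(1 / real CARD('n)) * (\<Sum>i\<in>UNIV. \<bar>X $ i $ j\<bar> * (row i X \<bullet> v)\<^sup>2) \<le> Q1 X A * (norm v)\<^sup>2"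
proof -
  define N where "N j = transpose (col_sub A X) ** diag_mat (\<lambda>i. \<bar>column j X $ i\<bar>) ** col_sub A X" for j
  define U where "U j = (1 / real CARD('n)) *\<^sub>R N j" for j
  have "transpose (U j) = U j"
    unfolding U_def N_def by (simp only: transpose_scalar transpose_gram)
  moreover have "(U j *v w) $ k = 0" if "k \<notin> A" for w k
    using gram_vector_outside[OF that, of X _ A w]
    by (simp add: U_def N_def scaleR_matrix_vector_assoc[symmetric])
  ultimately have "v \<bullet> (U j *v v) \<le> lambda_max_on A (U j) * (norm v)\<^sup>2"
    using v \<open>A \<noteq> {}\<close> by (intro quadratic_form_le_lambda_max_on) auto
  also have "lambda_max_on A (U j) \<le> Q1 X A"
    unfolding Q1_def U_def N_def by (intro Max_ge) auto
  finally show ?thesis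
    using gram_quadratic_form[OF v, where d = "\<lambda>i. \<bar>column j X $ i\<bar>"]
    by (simp add: U_def N_def scaleR_matrix_vector_assoc[symmetric] column_def mult_right_mono)
qed

text \<open>On matrices supported on the \<open>A\<close> block,
  \<open>diag_mat (indicator A)\<close> acts as the identity, so the usual uniqueness argument for
  inverses works.\<close>

lemma matrix_inv_on_eq:
  fixes U V :: "real ^ 'p ^ 'p"
  assumes V: "is_inverse_on A U V"
  shows "matrix_inv_on A U = V"
  unfolding matrix_inv_on_def
proof (rule the_equality[of "is_inverse_on A U", OF V])
  fix V' assume V': "is_inverse_on A U V'"
  have "V' = V' ** diag_mat (indicator A)"
    using V' by (auto simp: vec_eq_iff matrix_mul_diag_mat is_inverse_on_def indicator_def)
  also have "\<dots> = V' ** U ** V"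
    using V by (simp add: is_inverse_on_def matrix_mul_assoc[symmetric])
  also have "\<dots> = diag_mat (indicator A) ** V"
    using V' by (simp add: is_inverse_on_def)
  also have "\<dots> = V"
    using V by (auto simp: vec_eq_iff diag_mat_matrix_mul is_inverse_on_def indicator_def)
  finally show "V' = V" .
qed

text \<open>\<open>Q2\<close> inverts the Gram matrix divided by the sample size and
  \<open>Q3\<close> the unscaled one; this lets a single inverse serve both.\<close>

lemma is_inverse_on_scaleR:
  fixes U V :: "real ^ 'p ^ 'p"
  assumes "is_inverse_on A U V" "c \<noteq> 0"
  shows "is_inverse_on A (c *\<^sub>R U) ((1 / c) *\<^sub>R V)"
  using assms
  by (auto simp: is_inverse_on_def scalar_matrix_assoc[symmetric] matrix_scalar_ac)

lemma linf_norm_bound: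
  fixes U :: "real ^ 'p ^ 'n"
  assumes "\<And>k. \<bar>v $ k\<bar> \<le> g"
  shows "\<bar>(U *v v) $ j\<bar> \<le> linf_norm U * g"
proof -
  have "0 \<le> g" using assms[of undefined] abs_ge_zero order_trans by blast
  have "\<bar>(U *v v) $ j\<bar> \<le> (\<Sum>k\<in>UNIV. \<bar>U $ j $ k * v $ k\<bar>)"
    unfolding matrix_vector_mult_def by simp
  also have "\<dots> \<le> (\<Sum>k\<in>UNIV. \<bar>U $ j $ k\<bar>) * g"
    unfolding sum_distrib_right abs_mult using assms by (intro sum_mono mult_left_mono) auto
  also have "\<dots> \<le> linf_norm U * g"
    unfolding linf_norm_def using \<open>0 \<le> g\<close> by (intro mult_right_mono Max_ge) auto
  finally show ?thesis .
qed

lemma linf_norm_nonneg: "0 \<le> linf_norm (U :: real ^ 'p ^ 'n)"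
proof -
  have "0 \<le> (\<Sum>k\<in>UNIV. \<bar>U $ undefined $ k\<bar>)" by (simp add: sum_nonneg)
  also have "\<dots> \<le> linf_norm U"
    unfolding linf_norm_def by (intro Max_ge) auto
  finally show ?thesis .
qed

section \<open>The oracle estimator and the LLA steps\<close>

text \<open>The block inverse makes the Gram matrix injective on vectors supported on
  \<open>A\<close>, so some row separates \<open>e\<close> from \<open>c\<close>, and there the loss
  lies strictly above its tangent. The weights may be taken at \<open>b\<close> rather than at
  \<open>c\<close>, since only injectivity matters.\<close>

lemma oracle_strict_min:
  fixes X :: "real ^ 'p ^ 'n"
  assumes inv: "is_inverse_on A (transpose (col_sub A X) ** Sigma_mat X b ** col_sub A X) V"
    and c: "\<And>j. j \<notin> A \<Longrightarrow> c $ j = 0" and e: "\<And>j. j \<notin> A \<Longrightarrow> e $ j = 0"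
    and grad: "\<And>j. j \<in> A \<Longrightarrow> logit_grad X y c $ j = 0"
    and "e \<noteq> c"
  shows "logit_loss X y c < logit_loss X y e"
proof -
  have ec: "\<And>j. j \<notin> A \<Longrightarrow> (e - c) $ j = 0"
    using c e by simp
  have "\<exists>i. row i X \<bullet> e \<noteq> row i X \<bullet> c"
  proof (rule ccontr)
    assume "\<not> ?thesis"
    then have zero: "row i X \<bullet> (e - c) = 0" for i
      by (simp add: inner_diff_right)
    have "(transpose (col_sub A X) ** Sigma_mat X b ** col_sub A X) *v (e - c) = 0"
      unfolding vec_eq_iff Sigma_mat_def by (simp add: gram_vector[OF ec] zero del: vector_minus_component)
    then have "(V ** (transpose (col_sub A X) ** Sigma_mat X b ** col_sub A X)) *v (e - c) = 0"
      by (simp add: matrix_vector_mul_assoc[symmetric])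
    then have "diag_mat (indicator A) *v (e - c) = 0"
      using inv by (simp add: is_inverse_on_def)
    then have "indicator A j * (e - c) $ j = (0 :: real)" for j
      by (metis diag_mat_vector zero_index)
    then have "(e - c) $ j = 0" for j
      using ec[of j] by (cases "j \<in> A") (metis indicator_simps(1) mult_1, simp)
    then show False
      using \<open>e \<noteq> c\<close> by (simp add: vec_eq_iff)
  qed
  then obtain i where "row i X \<bullet> e \<noteq> row i X \<bullet> c" by blast
  from logit_loss_tangent_less[OF this]
  have "logit_loss X y c + logit_grad X y c \<bullet> (e - c) < logit_loss X y e" .
  moreover have "logit_grad X y c \<bullet> (e - c) = 0"
    unfolding inner_vec_def using grad ec by (intro sum.neutral) (metis inner_zero_left inner_zero_right)
  ultimately show ?thesis by simp
qed

lemma regular_oracleI: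
  fixes X :: "real ^ 'p ^ 'n"
  assumes "is_inverse_on A (transpose (col_sub A X) ** Sigma_mat X b ** col_sub A X) V"
    and "\<And>j. j \<notin> A \<Longrightarrow> c $ j = 0"
    and "\<And>j. j \<in> A \<Longrightarrow> logit_grad X y c $ j = 0"
  shows "regular_oracle X A y c"
proof -
  have *: "logit_loss X y c < logit_loss X y e" if "\<forall>j. j \<notin> A \<longrightarrow> e $ j = 0" "e \<noteq> c" for e
    using oracle_strict_min[OF assms(1,2) _ assms(3)] that by blast
  then show ?thesis
    using assms(2,3)
    unfolding regular_oracle_def is_unique_arg_min_def is_arg_min_def partial_deriv_logit_loss
    by (metis less_asym)
qed

text \<open>Off \<open>A\<close> each weight exceeds the gradient, so leaving 0 costs more in
  penalty than the tangent can gain; on \<open>A\<close> gradient and weight vanish. Points that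
  vanish off \<open>A\<close> gain nothing from this comparison and are left to
  \<open>strict\<close>.\<close>

lemma weighted_lasso_strict_min:
  fixes X :: "real ^ 'p ^ 'n"
  assumes c: "\<And>j. j \<notin> A \<Longrightarrow> c $ j = 0"
    and grad: "\<And>j. j \<in> A \<Longrightarrow> logit_grad X y c $ j = 0"
    and strict: "\<And>e. (\<And>j. j \<notin> A \<Longrightarrow> e $ j = 0) \<Longrightarrow> e \<noteq> c \<Longrightarrow> logit_loss X y c < logit_loss X y e"
    and w0: "\<And>j. j \<in> A \<Longrightarrow> w j = 0"
    and w: "\<And>j. j \<notin> A \<Longrightarrow> \<bar>logit_grad X y c $ j\<bar> < w j"
    and "e \<noteq> c"
  shows "logit_loss X y c + (\<Sum>j\<in>UNIV. w j * \<bar>c $ j\<bar>) < logit_loss X y e + (\<Sum>j\<in>UNIV. w j * \<bar>e $ j\<bar>)"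
proof -
  have wc: "(\<Sum>j\<in>UNIV. w j * \<bar>c $ j\<bar>) = 0"
    using w0 c by (intro sum.neutral) (metis abs_zero mult_zero_left mult_zero_right)
  show ?thesis
  proof (cases "\<forall>j. j \<notin> A \<longrightarrow> e $ j = 0")
    case True
    then have "(\<Sum>j\<in>UNIV. w j * \<bar>e $ j\<bar>) = 0"
      using w0 by (intro sum.neutral) (metis abs_zero mult_zero_left mult_zero_right)
    then show ?thesis
      using strict[of e] True \<open>e \<noteq> c\<close> wc by simp
  next
    case False
    then obtain k where k: "k \<notin> A" "e $ k \<noteq> 0" by blast
    \<comment> \<open>\<open>T j\<close> is the share of coordinate \<open>j\<close> in the lower
      bound for the increase of the objective, the loss being replaced by its tangent at
      \<open>c\<close>.\<close>
    define T where "T j = logit_grad X y c $ j * (e - c) $ j + w j * \<bar>e $ j\<bar>" for j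
    have T: "(\<bar>w j\<bar> - \<bar>logit_grad X y c $ j\<bar>) * \<bar>e $ j\<bar> \<le> T j" if "j \<notin> A" for j
    proof -
      have "\<bar>logit_grad X y c $ j * e $ j\<bar> = \<bar>logit_grad X y c $ j\<bar> * \<bar>e $ j\<bar>"
        by (rule abs_mult)
      moreover have "\<bar>w j\<bar> = w j" using w[OF that] by linarith
      ultimately show ?thesis
        using c[OF that] by (simp add: T_def left_diff_distrib)
    qed
    have pos: "0 < \<bar>w j\<bar> - \<bar>logit_grad X y c $ j\<bar>" if "j \<notin> A" for j
      using w[OF that] by linarith
    have "0 < sum T UNIV"
    proof (rule sum_pos2[of _ k])
      show "0 < T k"
        using T[OF k(1)] mult_pos_pos[OF pos[OF k(1)], of "\<bar>e $ k\<bar>"] k(2) by auto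
      show "0 \<le> T j" for j
      proof (cases "j \<in> A")
        case True
        then show ?thesis by (simp add: T_def grad w0)
      next
        case False
        then show ?thesis
          using T[OF False] mult_nonneg_nonneg[OF less_imp_le[OF pos[OF False]], of "\<bar>e $ j\<bar>"] by auto
      qed
    qed auto
    also have "sum T UNIV = logit_grad X y c \<bullet> (e - c) + (\<Sum>j\<in>UNIV. w j * \<bar>e $ j\<bar>)"
      by (simp add: T_def inner_vec_def sum.distrib)
    finally show ?thesis
      using logit_loss_tangent_le[of X y c e] wc by linarith
  qed
qed

lemma is_unique_arg_minI:
  assumes "S c" "\<And>e. S e \<Longrightarrow> e \<noteq> c \<Longrightarrow> f c < f e"
  shows "is_unique_arg_min f S c"
  using assms unfolding is_unique_arg_min_def is_arg_min_def by (metis less_asym)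

text \<open>The objective depends only on the previous iterate, so a second step that returns
  \<open>c\<close> repeats forever and the sequence is constant from index 1 on.\<close>

lemma lla_converges_to_oracleI:
  assumes "regular_oracle X A y c"
    and "is_unique_arg_min (lla_objective X y P b0) (\<lambda>_. True) c"
    and "is_unique_arg_min (lla_objective X y P c) (\<lambda>_. True) c"
  shows "lla_converges_to_oracle X A y P b0"
  unfolding lla_converges_to_oracle_def
proof (intro exI conjI)
  show "lla_sequence X y P b0 (\<lambda>m. if m = 0 then b0 else c)"
    using assms by (auto simp: lla_sequence_def)
qed (use assms in auto)

lemma lla_converges_to_oracle_iff:
  "lla_converges_to_oracle X A y P b0 \<longleftrightarrow> (\<exists>c. regular_oracle X A y c \<and>
     is_unique_arg_min (lla_objective X y P b0) (\<lambda>_. True) c \<and>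
     is_unique_arg_min (lla_objective X y P c) (\<lambda>_. True) c)"
proof
  assume "lla_converges_to_oracle X A y P b0"
  then obtain c b where *: "regular_oracle X A y c" "lla_sequence X y P b0 b" "b 1 = c" "b 2 = c"
    by (auto simp: lla_converges_to_oracle_def)
  then have "is_unique_arg_min (lla_objective X y P b0) (\<lambda>_. True) c"
    "is_unique_arg_min (lla_objective X y P c) (\<lambda>_. True) c"
    unfolding lla_sequence_def by (metis One_nat_def, metis One_nat_def Suc_1)
  with * show "\<exists>c. regular_oracle X A y c \<and>
     is_unique_arg_min (lla_objective X y P b0) (\<lambda>_. True) c \<and>
     is_unique_arg_min (lla_objective X y P c) (\<lambda>_. True) c" by blast
qed (use lla_converges_to_oracleI in blast)

text \<open>Existence and location of the oracle come together from a fixed point in a box around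
  \<open>b\<close>. \<open>Q\<close> stands for \<open>Q1\<close> but is kept abstract, because for
  empty \<open>A\<close> the maximum in \<open>Q1\<close> ranges over no eigenvalue.\<close>

lemma oracle_exists:
  fixes X :: "real ^ 'p ^ 'n"
  assumes inv: "is_inverse_on A (transpose (col_sub A X) ** Sigma_mat X b ** col_sub A X) V"
    and b: "\<And>j. j \<notin> A \<Longrightarrow> b $ j = 0"
    and Q: "\<And>j v. (\<And>k. k \<notin> A \<Longrightarrow> v $ k = 0) \<Longrightarrow>
      (1 / real CARD('n)) * (\<Sum>i\<in>UNIV. \<bar>X $ i $ j\<bar> * (row i X \<bullet> v)\<^sup>2) \<le> Q * (norm v)\<^sup>2"
    and "0 \<le> Q" "0 \<le> g"
    and g: "\<And>j. j \<in> A \<Longrightarrow> \<bar>logit_grad X y b $ j\<bar> \<le> g"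
    and small: "Q * (Q2 X A b)\<^sup>2 * real (card A) * g \<le> 1"
  obtains c where "\<And>j. j \<notin> A \<Longrightarrow> c $ j = 0"
    and "\<And>j. \<bar>c $ j - b $ j\<bar> \<le> 2 * Q2 X A b * g"
    and "\<And>j. j \<in> A \<Longrightarrow> logit_grad X y c $ j = 0"
    and "\<And>j. j \<notin> A \<Longrightarrow>
      \<bar>logit_grad X y c $ j\<bar> \<le> \<bar>logit_grad X y b $ j\<bar> + (1 + 2 * Q3 X A b) * g"
proof -
  define n where "n = real CARD('n)"
  have n: "0 < n" by (simp add: n_def)
  define sd where "sd i = sigm (row i X \<bullet> b) * (1 - sigm (row i X \<bullet> b))" for i
  have Sigma: "Sigma_mat X b = diag_mat sd"
    by (simp add: Sigma_mat_def deriv_psi deriv_sigm sd_def[abs_def])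
  define U where "U = transpose (col_sub A X) ** diag_mat sd ** col_sub A X"
  define H where "H = (1 / n) *\<^sub>R U"
  define W where "W = n *\<^sub>R V"
  have invU: "is_inverse_on A U V"
    using inv by (simp add: U_def Sigma)
  from is_inverse_on_scaleR[OF this, of "1 / n"] have invH: "is_inverse_on A H W"
    using n by (simp add: H_def W_def)
  have HW: "H ** W = diag_mat (indicator A)" and WH: "W ** H = diag_mat (indicator A)"
    and W0: "\<And>i j. i \<notin> A \<or> j \<notin> A \<Longrightarrow> W $ i $ j = 0"
    using invH by (auto simp: is_inverse_on_def)
  define q2 where "q2 = Q2 X A b"
  have q2: "q2 = linf_norm W"
    unfolding q2_def Q2_def Sigma n_def[symmetric] U_def[symmetric] H_def[symmetric]
    by (simp add: matrix_inv_on_eq[OF invH])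
  define K where "K = transpose (col_sub (- A) X) ** diag_mat sd ** col_sub A X ** V"
  define q3 where "q3 = Q3 X A b"
  have q3: "q3 = linf_norm K"
    unfolding q3_def Q3_def Sigma U_def[symmetric] by (simp add: K_def matrix_inv_on_eq[OF invU])
  have "0 \<le> q2" unfolding q2 by (rule linf_norm_nonneg)
  define r where "r = 2 * q2 * g"
  have "0 \<le> r" using \<open>0 \<le> q2\<close> \<open>0 \<le> g\<close> by (simp add: r_def)
  define S where "S = {d :: real ^ 'p. (\<forall>j. j \<notin> A \<longrightarrow> d $ j = 0) \<and> (\<forall>j. \<bar>d $ j\<bar> \<le> r)}"

  \<comment> \<open>\<open>lin d\<close> is the linear part of the change of the gradient, also in
    coordinates off \<open>A\<close>, and \<open>R d\<close> the Taylor remainder;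
    \<open>res\<close> deletes the coordinates off \<open>A\<close>.\<close>
  define lin where "lin d j = (1 / n) * (\<Sum>i\<in>UNIV. X $ i $ j * sd i * (row i X \<bullet> d))" for d j
  define R where "R d j = logit_grad X y (b + d) $ j - logit_grad X y b $ j - lin d j" for d j
  define res where "res z = (\<chi> j. if j \<in> A then z j else (0 :: real))" for z :: "'p \<Rightarrow> real"
  have W_res: "W *v z = W *v res (($) z)" for z
    unfolding matrix_vector_mult_def res_def vec_eq_iff using W0 by (auto intro!: sum.cong)
  have W_out: "(W *v z) $ j = 0" if "j \<notin> A" for z j
    using W0 that by (simp add: matrix_vector_mult_def)
  have Hv: "H *v d = res (lin d)" if "\<And>j. j \<notin> A \<Longrightarrow> d $ j = 0" for d
    using gram_vector[OF that, where B = A and X = X and d = sd]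
    by (simp add: vec_eq_iff H_def U_def res_def lin_def scaleR_matrix_vector_assoc[symmetric])
  have WHd: "W *v res (lin d) = d" if "\<And>j. j \<notin> A \<Longrightarrow> d $ j = 0" for d
  proof -
    have "W *v res (lin d) = diag_mat (indicator A) *v d"
      by (simp add: Hv[OF that, symmetric] matrix_vector_mul_assoc WH)
    also have "\<dots> = d"
      using that by (auto simp: vec_eq_iff diag_mat_vector indicator_def)
    finally show ?thesis .
  qed
  have R: "\<bar>R d j\<bar> \<le> g" if d: "d \<in> S" for d j
  proof -
    have "R d j = (1 / n) * (\<Sum>i\<in>UNIV. X $ i $ j * (sigm (row i X \<bullet> b + row i X \<bullet> d)
        - sigm (row i X \<bullet> b) - sd i * (row i X \<bullet> d)))"
      unfolding R_def lin_def logit_grad_def n_def[symmetric] vec_lambda_beta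
        right_diff_distrib[symmetric] sum_subtractf[symmetric]
      by (intro arg_cong2[of _ _ _ _ "(*)"] refl sum.cong) (simp add: inner_add_right algebra_simps)
    then have "\<bar>R d j\<bar> = (1 / n) * \<bar>\<Sum>i\<in>UNIV. X $ i $ j * (sigm (row i X \<bullet> b + row i X \<bullet> d)
        - sigm (row i X \<bullet> b) - sd i * (row i X \<bullet> d))\<bar>"
      using n by (simp add: abs_mult)
    also have "\<dots> \<le> (1 / n) * (\<Sum>i\<in>UNIV. \<bar>X $ i $ j\<bar> * ((row i X \<bullet> d)\<^sup>2 / 4))"
      using n sigm_taylor
      by (intro mult_left_mono order_trans[OF sum_abs] sum_mono)
        (simp_all add: abs_mult sd_def del: le_divide_eq_numeral1 times_divide_eq_right, intro mult_left_mono, auto)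
    also have "\<dots> = ((1 / n) * (\<Sum>i\<in>UNIV. \<bar>X $ i $ j\<bar> * (row i X \<bullet> d)\<^sup>2)) / 4"
      by (simp add: sum_divide_distrib mult.commute)
    also have "\<dots> \<le> Q * (norm d)\<^sup>2 / 4"
      using Q[of d j] d by (simp add: S_def n_def)
    finally have 1: "\<bar>R d j\<bar> \<le> Q * (norm d)\<^sup>2 / 4" .
    have 2: "(norm d)\<^sup>2 = (\<Sum>j\<in>A. (d $ j)\<^sup>2)"
      using d by (subst power2_norm_eq_inner)
        (auto simp: inner_vec_def power2_eq_square S_def intro!: sum.mono_neutral_right)
    have 3: "(\<Sum>j\<in>A. (d $ j)\<^sup>2) \<le> (\<Sum>j\<in>A. r\<^sup>2)"
      using d \<open>0 \<le> r\<close> by (intro sum_mono) (auto simp: S_def abs_le_square_iff[symmetric])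
    from 1 have "\<bar>R d j\<bar> \<le> Q * (\<Sum>j\<in>A. (d $ j)\<^sup>2) / 4"
      by (simp only: 2)
    also have "\<dots> \<le> Q * (\<Sum>j\<in>A. r\<^sup>2) / 4"
      using \<open>0 \<le> Q\<close> 3 by (intro divide_right_mono mult_left_mono) auto
    \<comment> \<open>The 4 cancels against \<open>r^2 = 4 q2^2 g^2\<close>; one factor
      \<open>g\<close> is set aside so that \<open>small\<close> applies to the rest.\<close>
    also have "\<dots> = (Q * q2\<^sup>2 * real (card A) * g) * g"
      by (simp add: r_def power2_eq_square)
    also have "\<dots> \<le> 1 * g"
      using small \<open>0 \<le> g\<close> by (intro mult_right_mono) (auto simp: q2_def)
    finally show ?thesis by simp
  qed

  \<comment> \<open>\<open>N d\<close> is the gradient on \<open>A\<close> without its linear part;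
    the gradient at \<open>b\<close> and the remainder contribute at most \<open>g\<close>
    each.\<close>
  define N where "N d = res (\<lambda>j. logit_grad X y b $ j + R d j)" for d
  have N: "\<bar>N d $ j\<bar> \<le> 2 * g" if "d \<in> S" for d j
    using g[of j] R[OF that, of j] \<open>0 \<le> g\<close> by (auto simp: N_def res_def)
  \<comment> \<open>A Newton map with the Hessian frozen at \<open>b\<close>. The linear part
    cancels \<open>d\<close>, leaving \<open>W\<close> applied to \<open>N d\<close>, of size at
    most \<open>2 q2 g = r\<close>.\<close>
  define F where "F d = d - W *v logit_grad X y (b + d)" for d
  have F: "F d = - (W *v N d)" if d: "d \<in> S" for d
  proof -
    have "res (($) (logit_grad X y (b + d))) = N d + res (lin d)"
      by (auto simp: vec_eq_iff res_def N_def R_def)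
    then have "W *v logit_grad X y (b + d) = W *v N d + W *v res (lin d)"
      by (subst W_res) (simp add: matrix_vector_right_distrib)
    then show ?thesis
      using d WHd[of d] by (simp add: F_def S_def)
  qed
  have "F d \<in> S" if "d \<in> S" for d
    using linf_norm_bound[OF N[OF that], of W] W_out
    unfolding F[OF that] by (simp add: S_def q2 r_def mult_ac)
  then have "F \<in> S \<rightarrow> S" by blast
  moreover have "compact S"
  proof -
    have "closed S"
      unfolding S_def
      by (intro closed_Collect_conj closed_Collect_all closed_Collect_imp closed_Collect_eq
          closed_Collect_le continuous_intros open_Collect_const)
    moreover have "bounded S"
      unfolding S_def
      by (intro boundedI[of _ "real CARD('p) * r"])
        (auto intro!: order_trans[OF norm_le_l1_cart] sum_bounded_above)
    ultimately show ?thesis by (simp add: compact_eq_bounded_closed)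
  qed
  moreover have "convex S"
  proof (rule convexI)
    fix x z :: "real ^ 'p" and u v :: real
    assume *: "x \<in> S" "z \<in> S" "0 \<le> u" "0 \<le> v" "u + v = 1"
    have "\<bar>u * x $ j + v * z $ j\<bar> \<le> r" for j
    proof -
      have "\<bar>u * x $ j + v * z $ j\<bar> \<le> u * \<bar>x $ j\<bar> + v * \<bar>z $ j\<bar>"
        using abs_triangle_ineq[of "u * x $ j" "v * z $ j"] * by (simp add: abs_mult)
      also have "\<dots> \<le> u * r + v * r"
        using * by (intro add_mono mult_left_mono) (auto simp: S_def)
      finally show ?thesis using * by (simp add: distrib_right[symmetric])
    qed
    with * show "u *\<^sub>R x + v *\<^sub>R z \<in> S" by (simp add: S_def)
  qed
  moreover have "S \<noteq> {}"
    using \<open>0 \<le> r\<close> by (auto simp: S_def intro!: exI[of _ 0])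
  moreover have "continuous_on S F"
  proof -
    have "continuous_on S (\<lambda>d. logit_grad X y (b + d))"
      by (intro continuous_intros)
    from continuous_on_compose2[OF matrix_vector_mult_linear_continuous_on[of UNIV W] this]
    show ?thesis
      unfolding F_def by (intro continuous_on_diff continuous_on_id) simp
  qed
  ultimately obtain d where d: "d \<in> S" "F d = d"
    using brouwer[of S F] by metis
  have dA: "\<And>j. j \<notin> A \<Longrightarrow> d $ j = 0" using d(1) by (simp add: S_def)
  have dN: "d = - (W *v N d)" using F d by metis
  show thesis
  proof (rule that[of "b + d"])
    show "(b + d) $ j = 0" if "j \<notin> A" for j
      using b dA that by simp
    show "\<bar>(b + d) $ j - b $ j\<bar> \<le> 2 * Q2 X A b * g" for j
      using d(1) by (simp add: S_def r_def q2_def)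
    show "logit_grad X y (b + d) $ j = 0" if "j \<in> A" for j
    proof -
      \<comment> \<open>The fixed point only shows that \<open>W\<close> annihilates the gradient;
        multiplying by \<open>H\<close> recovers its coordinates in \<open>A\<close>.\<close>
      have "W *v res (($) (logit_grad X y (b + d))) = 0"
        using d(2) by (simp add: F_def W_res[symmetric])
      then have "diag_mat (indicator A) *v res (($) (logit_grad X y (b + d))) = 0"
        unfolding HW[symmetric] matrix_vector_mul_assoc[symmetric] by simp
      then have "indicator A j * res (($) (logit_grad X y (b + d))) $ j = (0 :: real)"
        by (metis diag_mat_vector zero_index)
      then show ?thesis using that by (simp add: res_def)
    qed
    show "\<bar>logit_grad X y (b + d) $ j\<bar> \<le> \<bar>logit_grad X y b $ j\<bar> + (1 + 2 * Q3 X A b) * g"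
      if j: "j \<notin> A" for j
    proof -
      define B where "B = transpose (col_sub (- A) X) ** diag_mat sd ** col_sub A X"
      have "lin d j = (1 / n) * (B *v d) $ j"
        using j by (simp add: lin_def B_def gram_vector[OF dA])
      also have "\<dots> = - (K *v N d) $ j"
      proof -
        \<comment> \<open>The fixed-point equation brings in \<open>n V\<close>, whose factor
          \<open>n\<close> cancels the mean, so that the matrix of \<open>Q3\<close>
          appears.\<close>
        have "B *v d = - (B *v (n *\<^sub>R (V *v N d)))"
          by (subst dN) (simp add: W_def scaleR_matrix_vector_assoc vec.neg)
        then show ?thesis
          using n by (simp add: K_def B_def matrix_vector_mult_scaleR matrix_vector_mul_assoc)
      qed
      finally have "\<bar>lin d j\<bar> \<le> q3 * (2 * g)"
        using linf_norm_bound[OF N[OF d(1)], of K j] by (simp add: q3)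
      moreover have "logit_grad X y (b + d) $ j = logit_grad X y b $ j + R d j + lin d j"
        by (simp add: R_def)
      ultimately show ?thesis
        using R[OF d(1), of j] unfolding q3_def[symmetric] by (simp add: algebra_simps)
    qed
  qed
qed

lemma folded_concave_weight_zero:
  assumes "folded_concave a1 a2 a lam P" "a * lam \<le> t"
  shows "pen_deriv P t = 0"
  using assms by (auto simp: folded_concave_def)

lemma folded_concave_weight_ge:
  assumes "folded_concave a1 a2 a lam P" "0 \<le> t" "t \<le> a2 * lam"
  shows "a1 * lam \<le> pen_deriv P t"
  using assms by (cases "t = 0") (auto simp: folded_concave_def)

text \<open>The bounds on \<open>b0\<close> place it where the penalty slope is 0 on
  \<open>A\<close> and at least \<open>a1 lam\<close> off \<open>A\<close>. This serves both steps,
  with \<open>b0\<close> the initial estimator first and \<open>c\<close> itself afterwards.\<close>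

lemma lla_step_oracle:
  fixes X :: "real ^ 'p ^ 'n"
  assumes inv: "is_inverse_on A (transpose (col_sub A X) ** Sigma_mat X b ** col_sub A X) V"
    and P: "folded_concave a1 a2 a lam P"
    and c: "\<And>j. j \<notin> A \<Longrightarrow> c $ j = 0"
    and grad: "\<And>j. j \<in> A \<Longrightarrow> logit_grad X y c $ j = 0"
    and grad_less: "\<And>j. j \<notin> A \<Longrightarrow> \<bar>logit_grad X y c $ j\<bar> < a1 * lam"
    and large: "\<And>j. j \<in> A \<Longrightarrow> a * lam \<le> \<bar>b0 $ j\<bar>"
    and small: "\<And>j. j \<notin> A \<Longrightarrow> \<bar>b0 $ j\<bar> \<le> a2 * lam"
  shows "is_unique_arg_min (lla_objective X y P b0) (\<lambda>_. True) c"
proof (rule is_unique_arg_minI)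
  fix e assume "e \<noteq> c"
  show "lla_objective X y P b0 c < lla_objective X y P b0 e"
    unfolding lla_objective_def
  proof (rule weighted_lasso_strict_min[OF c grad])
    show "logit_loss X y c < logit_loss X y e'" if "\<And>j. j \<notin> A \<Longrightarrow> e' $ j = 0" "e' \<noteq> c" for e'
      using inv c that(1) grad that(2) by (rule oracle_strict_min)
    show "pen_deriv P \<bar>b0 $ j\<bar> = 0" if "j \<in> A" for j
      using P large[OF that] by (rule folded_concave_weight_zero)
    show "\<bar>logit_grad X y c $ j\<bar> < pen_deriv P \<bar>b0 $ j\<bar>" if "j \<notin> A" for j
      using folded_concave_weight_ge[OF P abs_ge_zero small[OF that]] grad_less[OF that] by linarith
  qed (use \<open>e \<noteq> c\<close> in auto)
qed simp

text \<open>The assumptions see the responses only through the gradient at \<open>b\<close>; they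
  are the bounds that hold outside the exceptional events estimated later.\<close>

lemma lla_converges_deterministic:
  fixes X :: "real ^ 'p ^ 'n"
  assumes inv: "is_inverse_on A (transpose (col_sub A X) ** Sigma_mat X b ** col_sub A X) V"
    and P: "folded_concave a1 a2 a lam P" and "0 < lam"
    and b: "\<And>j. j \<notin> A \<Longrightarrow> b $ j = 0"
    and b_large: "\<And>j. j \<in> A \<Longrightarrow> (a + 1) * lam < \<bar>b $ j\<bar>"
    and b0: "infnorm (b0 - b) \<le> min 1 a2 * lam"
    and "0 \<le> g"
    and g: "\<And>j. j \<in> A \<Longrightarrow> \<bar>logit_grad X y b $ j\<bar> \<le> g"
    and g_Q: "A \<noteq> {} \<Longrightarrow> Q1 X A * (Q2 X A b)\<^sup>2 * real (card A) * g \<le> 1"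
    and g_large: "\<And>j. j \<in> A \<Longrightarrow> 2 * Q2 X A b * g < \<bar>b $ j\<bar> - a * lam"
    and g_out: "\<And>j. j \<notin> A \<Longrightarrow> \<bar>logit_grad X y b $ j\<bar> + (1 + 2 * Q3 X A b) * g < a1 * lam"
  shows "lla_converges_to_oracle X A y P b0"
proof -
  \<comment> \<open>The value 0 serves for empty \<open>A\<close>, where the only vector supported
    on \<open>A\<close> is 0.\<close>
  define Q where "Q = (if A = {} then 0 else Q1 X A)"
  have Q: "(1 / real CARD('n)) * (\<Sum>i\<in>UNIV. \<bar>X $ i $ j\<bar> * (row i X \<bullet> v)\<^sup>2) \<le> Q * (norm v)\<^sup>2"
    if "\<And>k. k \<notin> A \<Longrightarrow> v $ k = 0" for j v
  proof (cases "A = {}")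
    case True
    then have "v = 0" using that by (simp add: vec_eq_iff)
    then show ?thesis by simp
  next
    case False
    from gram_le_Q1[OF this that, of X j] show ?thesis using False by (simp add: Q_def)
  qed
  have "0 \<le> Q"
  proof (cases "A = {}")
    case False
    then obtain k where "k \<in> A" by blast
    have "0 \<le> (1 / real CARD('n)) * (\<Sum>i\<in>UNIV. \<bar>X $ i $ k\<bar> * (row i X \<bullet> axis k 1)\<^sup>2)"
      by (intro mult_nonneg_nonneg sum_nonneg) auto
    also have "\<dots> \<le> Q * (norm (axis k (1 :: real) :: real ^ 'p))\<^sup>2"
      by (rule Q) (use \<open>k \<in> A\<close> in \<open>auto simp: axis_def\<close>)
    finally show ?thesis by (simp add: norm_axis_1)
  qed (simp add: Q_def)
  have "Q * (Q2 X A b)\<^sup>2 * real (card A) * g \<le> 1"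
    using g_Q by (simp add: Q_def)
  from oracle_exists[OF inv b Q \<open>0 \<le> Q\<close> \<open>0 \<le> g\<close> g this]
  obtain c where c: "\<And>j. j \<notin> A \<Longrightarrow> c $ j = 0"
    and close: "\<And>j. \<bar>c $ j - b $ j\<bar> \<le> 2 * Q2 X A b * g"
    and grad: "\<And>j. j \<in> A \<Longrightarrow> logit_grad X y c $ j = 0"
    and grad_le: "\<And>j. j \<notin> A \<Longrightarrow>
      \<bar>logit_grad X y c $ j\<bar> \<le> \<bar>logit_grad X y b $ j\<bar> + (1 + 2 * Q3 X A b) * g"
    by blast
  have grad_less: "\<bar>logit_grad X y c $ j\<bar> < a1 * lam" if "j \<notin> A" for j
    using grad_le[OF that] g_out[OF that] by linarith
  have a: "0 < a2" using P by (auto simp: folded_concave_def)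
  have dist: "\<bar>b0 $ j - b $ j\<bar> \<le> min 1 a2 * lam" for j
    using component_le_infnorm_cart[of "b0 - b" j] b0 by simp
  have min_lam: "min 1 a2 * lam \<le> 1 * lam" "min 1 a2 * lam \<le> a2 * lam"
    using \<open>0 < lam\<close> by (auto intro!: mult_right_mono)
  show ?thesis
  proof (rule lla_converges_to_oracleI)
    show "regular_oracle X A y c"
      using inv c grad by (rule regular_oracleI)
    show "is_unique_arg_min (lla_objective X y P b0) (\<lambda>_. True) c"
    proof (rule lla_step_oracle[OF inv P c grad grad_less])
      \<comment> \<open>The signal exceeds \<open>(a + 1) lam\<close>, and the initial error is at
        most \<open>lam\<close>.\<close>
      show "a * lam \<le> \<bar>b0 $ j\<bar>" if "j \<in> A" for j
        using dist[of j] min_lam(1) b_large[OF that] by (simp add: distrib_right)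
      show "\<bar>b0 $ j\<bar> \<le> a2 * lam" if "j \<notin> A" for j
        using dist[of j] min_lam(2) b[OF that] by simp
    qed
    show "is_unique_arg_min (lla_objective X y P c) (\<lambda>_. True) c"
    proof (rule lla_step_oracle[OF inv P c grad grad_less])
      \<comment> \<open>In the second step the error is at most \<open>2 Q2 g\<close>, which is
        below the gap between signal and \<open>a lam\<close>.\<close>
      show "a * lam \<le> \<bar>c $ j\<bar>" if "j \<in> A" for j
        using close[of j] g_large[OF that] by linarith
      show "\<bar>c $ j\<bar> \<le> a2 * lam" if "j \<notin> A" for j
        using c[OF that] a \<open>0 < lam\<close> by simp
    qed
  qed
qed

section \<open>Measurability of the convergence event\<close>

text \<open>Values are linearly ordered, so a point that is not strictly worse than a minimizer is a
  minimizer too.\<close>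

lemma is_unique_arg_min_iff:
  "is_unique_arg_min f (\<lambda>_. True) c \<longleftrightarrow> (\<forall>e. e \<noteq> c \<longrightarrow> f c < f e)"
proof
  assume *: "is_unique_arg_min f (\<lambda>_. True) c"
  show "\<forall>e. e \<noteq> c \<longrightarrow> f c < f e"
  proof (intro allI impI, rule ccontr)
    fix e assume "e \<noteq> c" "\<not> f c < f e"
    then have "is_arg_min f (\<lambda>_. True) e"
      using * unfolding is_unique_arg_min_def is_arg_min_def by (meson le_less_trans not_less)
    then show False using * \<open>e \<noteq> c\<close> by (auto simp: is_unique_arg_min_def)
  qed
qed (blast intro: is_unique_arg_minI)

text \<open>For a fixed annulus around \<open>c\<close>, strict minimality on it is an open condition on \<open>w\<close> by
  compactness; countably many annuli exhaust the complement of \<open>c\<close>.\<close>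

lemma borel_strict_minimizer_parameters:
  fixes f :: "'a :: euclidean_space \<Rightarrow> 'b :: euclidean_space \<Rightarrow> real"
  assumes "continuous_on UNIV (\<lambda>z. f (fst z) (snd z))"
  shows "{w. \<forall>e. e \<noteq> c \<longrightarrow> f w c < f w e} \<in> sets borel"
proof -
  define K where "K k = cball c (real (Suc k)) - ball c (1 / real (Suc k))" for k
  have "compact (K k)" for k
    unfolding K_def by (intro compact_diff compact_cball open_ball)
  have "closed {w. \<exists>e. e \<in> K k \<and> (e, w) \<in> {z. f (snd z) (fst z) \<le> f (snd z) c}}" for k
  proof (rule closed_compact_projection[OF \<open>compact (K k)\<close>])
    have "continuous_on UNIV (\<lambda>z :: 'b \<times> 'a. f (fst (snd z, fst z)) (snd (snd z, fst z)))"
      by (rule continuous_on_compose2[OF assms]) (auto intro!: continuous_intros)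
    moreover have "continuous_on UNIV (\<lambda>z :: 'b \<times> 'a. f (fst (snd z, c)) (snd (snd z, c)))"
      by (rule continuous_on_compose2[OF assms]) (auto intro!: continuous_intros)
    ultimately show "closed {z. f (snd z) (fst z) \<le> f (snd z) c}"
      by (intro closed_Collect_le) simp_all
  qed
  then have "(\<Inter>k. - {w. \<exists>e. e \<in> K k \<and> (e, w) \<in> {z. f (snd z) (fst z) \<le> f (snd z) c}}) \<in> sets borel"
    by (intro sets.countable_INT' borel_open) (auto simp: open_closed)
  also have "(\<Inter>k. - {w. \<exists>e. e \<in> K k \<and> (e, w) \<in> {z. f (snd z) (fst z) \<le> f (snd z) c}}) =
      {w. \<forall>e. e \<noteq> c \<longrightarrow> f w c < f w e}"
  proof -
    have "(\<exists>k. e \<in> K k) \<longleftrightarrow> e \<noteq> c" for e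
    proof
      assume "e \<noteq> c"
      obtain k1 where k1: "dist c e < real k1" using reals_Archimedean2 by blast
      obtain k2 where k2: "inverse (real (Suc k2)) < dist c e"
        using reals_Archimedean[of "dist c e"] \<open>e \<noteq> c\<close> by auto
      have "inverse (real (Suc (max k1 k2))) \<le> inverse (real (Suc k2))"
        by (intro le_imp_inverse_le) auto
      then have "e \<in> K (max k1 k2)"
        using k1 k2 by (simp add: K_def inverse_eq_divide)
      then show "\<exists>k. e \<in> K k" by blast
    qed (auto simp: K_def)
    moreover have "(\<Inter>k. - {w. \<exists>e. e \<in> K k \<and> (e, w) \<in> {z. f (snd z) (fst z) \<le> f (snd z) c}}) =
        {w. \<forall>e. (\<exists>k. e \<in> K k) \<longrightarrow> f w c < f w e}"
      by (auto simp: not_le)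
    ultimately show ?thesis by simp
  qed
  finally show ?thesis .
qed

text \<open>The derivative is a pointwise limit of difference quotients of a monotone, hence Borel,
  function; the value at 0 is treated apart.\<close>

lemma borel_measurable_pen_deriv_abs:
  assumes mono: "mono_on {0..} P" and diff: "\<And>t. 0 < t \<Longrightarrow> P differentiable (at t)"
  shows "(\<lambda>x. pen_deriv P \<bar>x\<bar>) \<in> borel_measurable borel"
proof -
  \<comment> \<open>\<open>P\<close> is controlled only on the nonnegative half-line;
    \<open>max 0 t\<close> turns it into a monotone function on the whole line.\<close>
  have [measurable]: "(\<lambda>t. P (max 0 t)) \<in> borel_measurable borel"
    by (rule borel_measurable_mono) (auto simp: mono_def intro!: mono_onD[OF mono])
  have lim: "deriv P t = lim (\<lambda>k. (P (max 0 (t + inverse (real (Suc k)))) - P (max 0 t)) / inverse (real (Suc k)))"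
    if "0 < t" for t
  proof -
    have "(P has_real_derivative deriv P t) (at t)"
      using diff[OF that] by (simp add: DERIV_deriv_iff_real_differentiable)
    then have "((\<lambda>h. (P (t + h) - P t) / h) \<longlongrightarrow> deriv P t) (at 0)"
      by (rule DERIV_D)
    then have "(\<lambda>k. (P (t + inverse (real (Suc k))) - P t) / inverse (real (Suc k))) \<longlonglongrightarrow> deriv P t"
      using LIMSEQ_inverse_real_of_nat
      using LIMSEQ_SEQ_conv[of 0 "\<lambda>h. (P (t + h) - P t) / h" "deriv P t"]
      by (simp del: of_nat_Suc)
    moreover have "max 0 (t + inverse (real (Suc k))) = t + inverse (real (Suc k))" for k
      using that by simp
    ultimately show ?thesis
      using that by (simp add: limI)
  qed
  have "(\<lambda>x. pen_deriv P \<bar>x\<bar>) = (\<lambda>x. if x = 0 then pen_deriv P 0 else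
      lim (\<lambda>k. (P (max 0 (\<bar>x\<bar> + inverse (real (Suc k)))) - P (max 0 \<bar>x\<bar>)) / inverse (real (Suc k))))"
    by (auto simp: pen_deriv_def lim)
  also have "\<dots> \<in> borel_measurable borel"
    by measurable
  finally show ?thesis .
qed

lemma borel_measurable_vec_lambda:
  fixes f :: "'a \<Rightarrow> 'p :: finite \<Rightarrow> real"
  assumes "\<And>j. (\<lambda>x. f x j) \<in> borel_measurable M"
  shows "(\<lambda>x. \<chi> j. f x j) \<in> borel_measurable M"
  unfolding borel_measurable_euclidean_space[of "\<lambda>x. \<chi> j. f x j"]
  using assms by (auto simp: Basis_vec_def inner_axis)

text \<open>The initial estimator enters the objective only through the weights, which are a Borel
  function of it.\<close>

lemma sets_unique_arg_min_lla:
  fixes X :: "real ^ 'p ^ 'n"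
  assumes P: "mono_on {0..} P" "\<And>t. 0 < t \<Longrightarrow> P differentiable (at t)"
    and b0: "b0 \<in> borel_measurable M"
  shows "{\<omega> \<in> space M. is_unique_arg_min (lla_objective X y P (b0 \<omega>)) (\<lambda>_. True) c} \<in> sets M"
proof -
  define f where "f w e = logit_loss X y e + (\<Sum>j\<in>UNIV. w $ j * \<bar>e $ j\<bar>)" for w e :: "real ^ 'p"
  define W where "W \<omega> = (\<chi> j. pen_deriv P \<bar>b0 \<omega> $ j\<bar>)" for \<omega>
  have "(\<lambda>x :: real ^ 'p. x $ j) \<in> borel_measurable borel" for j
    by (intro borel_measurable_continuous_onI continuous_intros)
  from measurable_compose[OF measurable_compose[OF b0 this] borel_measurable_pen_deriv_abs[OF P]]
  have "(\<lambda>\<omega>. pen_deriv P \<bar>b0 \<omega> $ j\<bar>) \<in> borel_measurable M" for j .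
  then have W: "W \<in> borel_measurable M"
    unfolding W_def by (rule borel_measurable_vec_lambda)
  have "{w. \<forall>e. e \<noteq> c \<longrightarrow> f w c < f w e} \<in> sets borel"
    unfolding f_def by (intro borel_strict_minimizer_parameters continuous_intros)
  from measurable_sets[OF W this] show ?thesis
    by (simp add: vimage_def Int_def is_unique_arg_min_iff f_def W_def lla_objective_def conj_commute)
qed

text \<open>There are finitely many response vectors, and each fixes the oracle and the second step:
  either no initial value succeeds, or success is a first-step condition for one fixed
  \<open>c\<close>.\<close>

lemma sets_lla_converges_to_oracle:
  fixes X :: "real ^ 'p ^ 'n" and y :: "'n \<Rightarrow> 'w \<Rightarrow> bool"
  assumes P: "mono_on {0..} P" "\<And>t. 0 < t \<Longrightarrow> P differentiable (at t)"
    and b0: "b0 \<in> borel_measurable M"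
    and y [measurable]: "\<And>i. y i \<in> measurable M (count_space UNIV)"
  shows "{\<omega> \<in> space M. lla_converges_to_oracle X A (\<lambda>i. y i \<omega>) P (b0 \<omega>)} \<in> sets M"
proof -
  have "{\<omega> \<in> space M. lla_converges_to_oracle X A \<eta> P (b0 \<omega>)} \<in> sets M" for \<eta>
  proof (cases "\<exists>c. regular_oracle X A \<eta> c \<and> is_unique_arg_min (lla_objective X \<eta> P c) (\<lambda>_. True) c")
    case True
    then obtain c where c: "regular_oracle X A \<eta> c"
      "is_unique_arg_min (lla_objective X \<eta> P c) (\<lambda>_. True) c" by blast
    have "c' = c" if "regular_oracle X A \<eta> c'" for c'
      using c(1) that unfolding regular_oracle_def is_unique_arg_min_def by blast
    then have "lla_converges_to_oracle X A \<eta> P x \<longleftrightarrow>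
        is_unique_arg_min (lla_objective X \<eta> P x) (\<lambda>_. True) c" for x
      using c unfolding lla_converges_to_oracle_iff by blast
    then show ?thesis
      using sets_unique_arg_min_lla[OF P b0] by simp
  next
    case False
    then have "\<not> lla_converges_to_oracle X A \<eta> P x" for x
      unfolding lla_converges_to_oracle_iff by blast
    then show ?thesis by simp
  qed
  moreover have "{\<omega> \<in> space M. \<forall>i. y i \<omega> = \<eta> i} \<in> sets M" for \<eta>
    by measurable
  ultimately have "(\<Union>\<eta>. {\<omega> \<in> space M. \<forall>i. y i \<omega> = \<eta> i} \<inter>
      {\<omega> \<in> space M. lla_converges_to_oracle X A \<eta> P (b0 \<omega>)}) \<in> sets M"
    by (intro sets.finite_UN sets.Int) auto
  also have "(\<Union>\<eta>. {\<omega> \<in> space M. \<forall>i. y i \<omega> = \<eta> i} \<inter>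
      {\<omega> \<in> space M. lla_converges_to_oracle X A \<eta> P (b0 \<omega>)}) =
      {\<omega> \<in> space M. lla_converges_to_oracle X A (\<lambda>i. y i \<omega>) P (b0 \<omega>)}"
    by (auto simp: fun_eq_iff[symmetric])
  finally show ?thesis .
qed

section \<open>Concentration of the gradient\<close>

context prob_space
begin

text \<open>Hoeffding's inequality: summand \<open>i\<close> varies in an interval whose length is
  the absolute value of \<open>X $ i $ j\<close>, and the squared lengths add up to at most
  \<open>n D\<close>.\<close>

lemma prob_logit_grad_ge:
  fixes X :: "real ^ 'p ^ 'n" and y :: "'n \<Rightarrow> 'a \<Rightarrow> bool"
  assumes indep: "indep_vars (\<lambda>_. count_space UNIV) y UNIV"
    and distr: "\<And>i. distr M (count_space UNIV) (y i) = measure_pmf (bernoulli_pmf (sigm (row i X \<bullet> b)))"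
    and "0 \<le> t" and D: "(norm (column j X))\<^sup>2 / real CARD('n) \<le> D"
  shows "prob {\<omega> \<in> space M. t \<le> \<bar>logit_grad X (\<lambda>i. y i \<omega>) b $ j\<bar>} \<le>
    2 * exp (- (real CARD('n) / D * (2 * t\<^sup>2)))"
proof -
  define n where "n = real CARD('n)"
  have n: "0 < n" by (simp add: n_def)
  define S where "S = (\<Sum>i\<in>UNIV. (X $ i $ j)\<^sup>2)"
  have S: "(norm (column j X))\<^sup>2 = S"
    unfolding S_def power2_norm_eq_inner inner_vec_def
    by (simp add: column_def power2_eq_square)
  have y [measurable]: "random_variable (count_space UNIV) (y i)" for i
    using indep by (simp add: indep_vars_def2)
  have trivial: "prob {\<omega> \<in> space M. t \<le> \<bar>logit_grad X (\<lambda>i. y i \<omega>) b $ j\<bar>} \<le> 2"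
    by (rule order_trans[OF prob_le_1]) simp
  have "0 \<le> S" by (simp add: S_def sum_nonneg)
  \<comment> \<open>If \<open>t\<close> or \<open>D\<close> is 0, the exponent is 0 (division by 0
    being 0) and the bound 2 is trivial; a zero column has zero gradient. Hoeffding's inequality is
    applied with positive \<open>S\<close>.\<close>
  consider "t = 0" | "D = 0" | "0 < t" "S = 0" | "0 < S" "D \<noteq> 0"
    using \<open>0 \<le> t\<close> \<open>0 \<le> S\<close> by linarith
  then show ?thesis
  proof cases
    case 3
    then have "X $ i $ j = 0" for i
      by (auto simp: S_def sum_nonneg_eq_0_iff)
    then have "{\<omega> \<in> space M. t \<le> \<bar>logit_grad X (\<lambda>i. y i \<omega>) b $ j\<bar>} = {}"
      using \<open>0 < t\<close> by (simp add: logit_grad_def)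
    then show ?thesis by (simp only: measure_empty) simp
  next
    case 4
    have "0 < D" using 4 D S \<open>0 < S\<close> n by (metis divide_pos_pos less_le_trans n_def)
    define Z where "Z i \<omega> = X $ i $ j * (of_bool (y i \<omega>) :: real)" for i \<omega>
    have "expectation (\<lambda>\<omega>. of_bool (y i \<omega>)) = sigm (row i X \<bullet> b)" for i
    proof -
      have "expectation (\<lambda>\<omega>. of_bool (y i \<omega>)) =
          integral\<^sup>L (distr M (count_space UNIV) (y i)) (of_bool :: bool \<Rightarrow> real)"
        by (rule integral_distr[symmetric]) auto
      also have "\<dots> = sigm (row i X \<bullet> b)"
        unfolding distr using sigm_bounds[of "row i X \<bullet> b"] by simp
      finally show ?thesis .
    qed
    then have EZ: "expectation (Z i) = X $ i $ j * sigm (row i X \<bullet> b)" for i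
      unfolding Z_def by simp
    have "indep_vars (\<lambda>_. borel) Z UNIV"
      unfolding Z_def by (rule indep_vars_compose2[OF indep]) auto
    \<comment> \<open>The entry may have either sign, hence \<open>min\<close> and
      \<open>max\<close> with 0.\<close>
    then interpret Hoeffding_ineq M UNIV Z "\<lambda>i. min 0 (X $ i $ j)" "\<lambda>i. max 0 (X $ i $ j)"
        "\<Sum>i\<in>UNIV. X $ i $ j * sigm (row i X \<bullet> b)"
      by unfold_locales (auto simp: Z_def EZ of_bool_def)
    have width: "(\<Sum>i\<in>UNIV. (max 0 (X $ i $ j) - min 0 (X $ i $ j))\<^sup>2) = S"
      unfolding S_def by (intro sum.cong) (auto simp: max_def min_def)
    have "{\<omega> \<in> space M. t \<le> \<bar>logit_grad X (\<lambda>i. y i \<omega>) b $ j\<bar>} =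
        {\<omega> \<in> space M. n * t \<le> \<bar>(\<Sum>i\<in>UNIV. Z i \<omega>) - (\<Sum>i\<in>UNIV. X $ i $ j * sigm (row i X \<bullet> b))\<bar>}"
    proof (intro Collect_cong conj_cong refl)
      fix \<omega>
      have "logit_grad X (\<lambda>i. y i \<omega>) b $ j =
          (1 / n) * ((\<Sum>i\<in>UNIV. X $ i $ j * sigm (row i X \<bullet> b)) - (\<Sum>i\<in>UNIV. Z i \<omega>))"
        by (simp add: logit_grad_def Z_def n_def sum_subtractf right_diff_distrib)
      then have "n * \<bar>logit_grad X (\<lambda>i. y i \<omega>) b $ j\<bar> =
          \<bar>(\<Sum>i\<in>UNIV. Z i \<omega>) - (\<Sum>i\<in>UNIV. X $ i $ j * sigm (row i X \<bullet> b))\<bar>"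
        using n by (simp add: abs_mult abs_minus_commute)
      then show "t \<le> \<bar>logit_grad X (\<lambda>i. y i \<omega>) b $ j\<bar> \<longleftrightarrow>
          n * t \<le> \<bar>(\<Sum>i\<in>UNIV. Z i \<omega>) - (\<Sum>i\<in>UNIV. X $ i $ j * sigm (row i X \<bullet> b))\<bar>"
        using n by (metis mult_le_cancel_left_pos)
    qed
    also have "prob \<dots> \<le> 2 * exp (- 2 * (n * t)\<^sup>2 / S)"
      using Hoeffding_ineq_abs_ge[of "n * t"] 4 n \<open>0 \<le> t\<close> unfolding width by simp
    also have "\<dots> \<le> 2 * exp (- (n / D * (2 * t\<^sup>2)))"
    proof -
      have "S \<le> n * D" using D n by (simp add: S n_def divide_le_eq mult.commute)
      then have "2 * (n * t)\<^sup>2 / (n * D) \<le> 2 * (n * t)\<^sup>2 / S"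
        using 4 n \<open>0 < D\<close> by (intro divide_left_mono) auto
      also have "2 * (n * t)\<^sup>2 / (n * D) = n / D * (2 * t\<^sup>2)"
        using n by (simp add: power2_eq_square)
      finally show ?thesis by simp
    qed
    finally show ?thesis by (simp add: n_def)
  qed (use trivial in auto)
qed

lemma prob_logit_grad_ge_UN:
  fixes X :: "real ^ 'p ^ 'n" and y :: "'n \<Rightarrow> 'a \<Rightarrow> bool" and B :: "'p set"
  assumes indep: "indep_vars (\<lambda>_. count_space UNIV) y UNIV"
    and distr: "\<And>i. distr M (count_space UNIV) (y i) = measure_pmf (bernoulli_pmf (sigm (row i X \<bullet> b)))"
    and "0 \<le> t" and D: "\<And>j. (norm (column j X))\<^sup>2 / real CARD('n) \<le> D"
  shows "prob (\<Union>j\<in>B. {\<omega> \<in> space M. t \<le> \<bar>logit_grad X (\<lambda>i. y i \<omega>) b $ j\<bar>}) \<le>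
      2 * real (card B) * exp (- (real CARD('n) / D * (2 * t\<^sup>2)))"
    and "{\<omega> \<in> space M. t \<le> \<bar>logit_grad X (\<lambda>i. y i \<omega>) b $ j\<bar>} \<in> events"
proof -
  have [measurable]: "random_variable (count_space UNIV) (y i)" for i
    using indep by (simp add: indep_vars_def2)
  show ev: "{\<omega> \<in> space M. t \<le> \<bar>logit_grad X (\<lambda>i. y i \<omega>) b $ j\<bar>} \<in> events" for j
    unfolding logit_grad_def by (simp, measurable)
  have "prob (\<Union>j\<in>B. {\<omega> \<in> space M. t \<le> \<bar>logit_grad X (\<lambda>i. y i \<omega>) b $ j\<bar>}) \<le>
      (\<Sum>j\<in>B. prob {\<omega> \<in> space M. t \<le> \<bar>logit_grad X (\<lambda>i. y i \<omega>) b $ j\<bar>})"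
    using ev by (intro finite_measure_subadditive_finite) auto
  also have "\<dots> \<le> (\<Sum>j\<in>B. 2 * exp (- (real CARD('n) / D * (2 * t\<^sup>2))))"
    by (intro sum_mono prob_logit_grad_ge[OF indep distr \<open>0 \<le> t\<close> D])
  finally show "prob (\<Union>j\<in>B. {\<omega> \<in> space M. t \<le> \<bar>logit_grad X (\<lambda>i. y i \<omega>) b $ j\<bar>}) \<le>
      2 * real (card B) * exp (- (real CARD('n) / D * (2 * t\<^sup>2)))"
    by simp
qed

end

section \<open>The probability bound\<close>

text \<open>Turns a squared threshold from an exponent into a linear condition on \<open>g\<close>.
  The premise excludes \<open>z = 0\<close>, where its right-hand side is 0 by the convention for
  division.\<close>

lemma mult_le_1_if_square_less:
  fixes g z :: real
  assumes "g\<^sup>2 < 1 / z\<^sup>2"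
  shows "g * z \<le> 1"
proof -
  have "z \<noteq> 0" using assms zero_le_power2[of g] by (cases "z = 0") auto
  then have "(g * z)\<^sup>2 < 1"
    using assms by (simp add: power_mult_distrib less_divide_eq)
  then show ?thesis using abs_square_less_1[of "g * z"] by simp
qed

lemma mult_less_if_square_less:
  fixes c g z :: real
  assumes "g\<^sup>2 < c\<^sup>2 / z\<^sup>2" "0 \<le> c"
  shows "g * z < c"
proof -
  have "z \<noteq> 0" using assms zero_le_power2[of g] by (cases "z = 0") auto
  then have "(g * z)\<^sup>2 < c\<^sup>2"
    using assms by (simp add: power_mult_distrib less_divide_eq)
  then show ?thesis using \<open>0 \<le> c\<close> by (rule power2_less_imp_less)
qed

text \<open>Invertibility gives \<open>Q2\<close> and \<open>Q3\<close> their meaning and makes the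
  oracle unique. The lower bound on the signal keeps every estimate within \<open>a0 lam\<close> of
  \<open>beta_star\<close> in the flat range of the penalty on \<open>A\<close>.\<close>

theorem theorem4:
  fixes Pr :: "'w measure"
    and X :: "real ^ 'p ^ 'n"
    and y :: "'n \<Rightarrow> 'w \<Rightarrow> bool"
    and beta_star :: "real ^ 'p"
    and beta_init :: "'w \<Rightarrow> real ^ 'p"
    and P :: "real \<Rightarrow> real"
    and a1 a2 a lam :: real
  defines "A \<equiv> support beta_star"
    and "n \<equiv> real CARD('n)" and "p \<equiv> real CARD('p)" and "s \<equiv> real (card (support beta_star))"
    and "a0 \<equiv> min 1 a2"
    and "M \<equiv> Max (range (\<lambda>j. (norm (column j X))\<^sup>2 / real CARD('n)))"
    and "q1 \<equiv> Q1 X (support beta_star)"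
    and "q2 \<equiv> Q2 X (support beta_star) beta_star"
    and "q3 \<equiv> Q3 X (support beta_star) beta_star"
  defines "delta0 \<equiv> measure Pr {\<omega> \<in> space Pr. infnorm (beta_init \<omega> - beta_star) > a0 * lam}"
    and "delta1 \<equiv>
      2 * s * exp (- (n / M) * min (2 / (q1\<^sup>2 * q2 ^ 4 * s\<^sup>2))
                                   (a1\<^sup>2 * lam\<^sup>2 / (2 * (1 + 2 * q3)\<^sup>2)))
      + 2 * (p - s) * exp (- (a1\<^sup>2 * n * lam\<^sup>2 / (2 * M)))"
    and "delta2 \<equiv>
      2 * s * exp (- (n / (M * q2\<^sup>2)) * min (2 / (q1\<^sup>2 * q2\<^sup>2 * s\<^sup>2))
                                          (1 / 2 * (min_norm_on A beta_star - a * lam)\<^sup>2))"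
  assumes "prob_space Pr"
    and "prob_space.indep_vars Pr (\<lambda>_. count_space UNIV) y UNIV"
    and "\<And>i. distr Pr (count_space UNIV) (y i) =
           measure_pmf (bernoulli_pmf (exp (row i X \<bullet> beta_star) / (1 + exp (row i X \<bullet> beta_star))))"
    and "beta_init \<in> borel_measurable Pr"
    and "lam > 0"
    and "folded_concave a1 a2 a lam P"
    and "invertible_on A (transpose (col_sub A X) ** Sigma_mat X beta_star ** col_sub A X)"
    and "\<forall>j\<in>A. \<bar>beta_star $ j\<bar> > (a + 1) * lam"
  shows "measure Pr {\<omega> \<in> space Pr. lla_converges_to_oracle X A (\<lambda>i. y i \<omega>) P (beta_init \<omega>)}
           \<ge> 1 - delta0 - delta1 - delta2"
proof -
  interpret prob_space Pr by fact
  have A: "A = support beta_star" and s: "s = real (card A)"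
    by (simp_all add: A_def s_def)
  have q1: "q1 = Q1 X A" and q2: "q2 = Q2 X A beta_star" and q3: "q3 = Q3 X A beta_star"
    by (simp_all add: A_def q1_def q2_def q3_def)
  have "0 \<le> q3" "0 \<le> q2"
    by (simp_all add: q2 q3 Q2_def Q3_def linf_norm_nonneg)
  have beta0: "beta_star $ j = 0" if "j \<notin> A" for j
    using that by (simp add: A support_def)
  have beta_large: "(a + 1) * lam < \<bar>beta_star $ j\<bar>" if "j \<in> A" for j
    using assms(20) that by blast
  have P: "folded_concave a1 a2 a lam P" and "0 < lam" by fact+
  then have P': "mono_on {0..} P" "\<And>t. 0 < t \<Longrightarrow> P differentiable (at t)" and "0 < a1"
    by (auto simp: folded_concave_def)
  obtain V where inv:
    "is_inverse_on A (transpose (col_sub A X) ** Sigma_mat X beta_star ** col_sub A X) V"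
    using assms(19) by (auto simp: invertible_on_def)
  have indep: "indep_vars (\<lambda>_. count_space UNIV) y UNIV" by fact
  then have y: "random_variable (count_space UNIV) (y i)" for i
    by (simp add: indep_vars_def2)
  have distr: "distr Pr (count_space UNIV) (y i) =
      measure_pmf (bernoulli_pmf (sigm (row i X \<bullet> beta_star)))" for i
    using assms(15) by (simp add: sigm_def)
  have M: "(norm (column j X))\<^sup>2 / real CARD('n) \<le> M" for j
    unfolding M_def by (intro Max_ge) auto

  define G where "G \<omega> j = \<bar>logit_grad X (\<lambda>i. y i \<omega>) beta_star $ j\<bar>" for \<omega> j
  define mn where "mn = min_norm_on A beta_star"
  \<comment> \<open>The thresholds \<open>t1\<close> and \<open>t2\<close> below are such that twice
    their squares, times \<open>n / M\<close>, are the exponents with these minima in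
    \<open>delta1\<close> and \<open>delta2\<close>.\<close>
  define m1 where "m1 = min (2 / (q1\<^sup>2 * q2 ^ 4 * s\<^sup>2)) (a1\<^sup>2 * lam\<^sup>2 / (2 * (1 + 2 * q3)\<^sup>2))"
  define m2 where "m2 = min (2 / (q1\<^sup>2 * q2\<^sup>2 * s\<^sup>2)) (1 / 2 * (mn - a * lam)\<^sup>2)"
  have "0 \<le> m1" "0 \<le> m2" by (simp_all add: m1_def m2_def)
  \<comment> \<open>If \<open>q1\<close>, \<open>q2\<close> or \<open>M\<close> is 0, division by 0 makes the threshold or the exponent 0, and the tail
    bound below, then at least 2 for each coordinate, is trivial.\<close>
  define t1 where "t1 = sqrt (m1 / 2)"
  define t2 where "t2 = sqrt (m2 / (2 * q2\<^sup>2))"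
  \<comment> \<open>Half of the budget \<open>a1 lam\<close> goes to the gradient off
    \<open>A\<close> at \<open>beta_star\<close>, the other half to
    \<open>(1 + 2 q3) g\<close>.\<close>
  define t3 where "t3 = a1 * lam / 2"
  have t1: "t1\<^sup>2 = m1 / 2" "0 \<le> t1" and t2: "t2\<^sup>2 = m2 / (2 * q2\<^sup>2)" "0 \<le> t2"
    using \<open>0 \<le> m1\<close> \<open>0 \<le> m2\<close> by (simp_all add: t1_def t2_def)
  have "0 \<le> t3" using \<open>0 < a1\<close> \<open>0 < lam\<close> by (simp add: t3_def)

  define B0 where "B0 = {\<omega> \<in> space Pr. infnorm (beta_init \<omega> - beta_star) > a0 * lam}"
  define B where "B t C = (\<Union>j\<in>C. {\<omega> \<in> space Pr. t \<le> G \<omega> j})" for t C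
  define L where "L = {\<omega> \<in> space Pr. lla_converges_to_oracle X A (\<lambda>i. y i \<omega>) P (beta_init \<omega>)}"

  have L: "L \<in> events"
    unfolding L_def using P' \<open>beta_init \<in> borel_measurable Pr\<close> y
    by (rule sets_lla_converges_to_oracle)
  have "(\<lambda>x. infnorm (x - beta_star)) \<in> borel_measurable borel"
    by (intro borel_measurable_continuous_onI continuous_at_imp_continuous_on ballI
        continuous_infnorm continuous_intros)
  then have [measurable]: "(\<lambda>\<omega>. infnorm (beta_init \<omega> - beta_star)) \<in> borel_measurable Pr"
    using measurable_compose[OF \<open>beta_init \<in> borel_measurable Pr\<close>] by blast
  have B0: "B0 \<in> events" unfolding B0_def by measurable
  have B: "B t C \<in> events" "prob (B t C) \<le> 2 * real (card C) * exp (- (n / M * (2 * t\<^sup>2)))"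
    if "0 \<le> t" for t C
    using prob_logit_grad_ge_UN[OF indep distr that M]
    unfolding B_def G_def n_def by (auto intro!: sets.finite_UN)

  have "space Pr - (B0 \<union> B t1 A \<union> B t2 A \<union> B t3 (- A)) \<subseteq> L"
  proof
    fix \<omega> assume \<omega>: "\<omega> \<in> space Pr - (B0 \<union> B t1 A \<union> B t2 A \<union> B t3 (- A))"
    \<comment> \<open>Inserting 0 gives \<open>g\<close> a value for empty \<open>A\<close>.\<close>
    define g where "g = Max (insert 0 (G \<omega> ` A))"
    have g: "0 \<le> g" "\<And>j. j \<in> A \<Longrightarrow> G \<omega> j \<le> g"
      by (auto simp: g_def)
    \<comment> \<open>For empty \<open>A\<close> the event \<open>B t A\<close> is empty even if
      \<open>t = 0\<close>, where the strict inequality would fail; hence the first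
      condition.\<close>
    have g_less: "g\<^sup>2 < t\<^sup>2" if "A \<noteq> {}" "\<omega> \<notin> B t A" "0 \<le> t" for t
    proof -
      have "G \<omega> j < t" if "j \<in> A" for j
        using \<open>\<omega> \<notin> B t A\<close> \<omega> that by (auto simp: B_def not_le)
      moreover from this have "0 < t"
        using \<open>A \<noteq> {}\<close> by (metis G_def abs_ge_zero all_not_in_conv le_less_trans)
      ultimately have "g < t" by (auto simp: g_def)
      then show ?thesis using g(1) by (intro power_strict_mono) auto
    qed
    have "lla_converges_to_oracle X A (\<lambda>i. y i \<omega>) P (beta_init \<omega>)"
    proof (rule lla_converges_deterministic[OF inv P \<open>0 < lam\<close> beta0 beta_large _ \<open>0 \<le> g\<close>])
      show "infnorm (beta_init \<omega> - beta_star) \<le> min 1 a2 * lam"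
        using \<omega> by (auto simp: B0_def a0_def not_less)
      show "\<bar>logit_grad X (\<lambda>i. y i \<omega>) beta_star $ j\<bar> \<le> g" if "j \<in> A" for j
        using g(2)[OF that] by (simp add: G_def)
      show "Q1 X A * (Q2 X A beta_star)\<^sup>2 * real (card A) * g \<le> 1" if "A \<noteq> {}"
      proof -
        have "g\<^sup>2 < m1 / 2" using g_less[OF that _ t1(2)] \<omega> t1(1) by simp
        also have "\<dots> \<le> 1 / (q1 * q2\<^sup>2 * s)\<^sup>2"
          by (simp add: m1_def power_mult_distrib flip: power_mult)
        finally show ?thesis
          using mult_le_1_if_square_less by (simp add: q1 q2 s mult.commute)
      qed
      show "2 * Q2 X A beta_star * g < \<bar>beta_star $ j\<bar> - a * lam" if "j \<in> A" for j
      proof -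
        have "A \<noteq> {}" using that by blast
        have "a * lam < \<bar>beta_star $ j\<bar>" if "j \<in> A" for j
          using beta_large[OF that] \<open>0 < lam\<close> by (simp add: distrib_right)
        then have "a * lam < mn"
          unfolding mn_def min_norm_on_def using \<open>A \<noteq> {}\<close> by (subst Min_gr_iff) auto
        have "g\<^sup>2 < m2 / (2 * q2\<^sup>2)" using g_less[OF \<open>A \<noteq> {}\<close> _ t2(2)] \<omega> t2(1) by simp
        also have "\<dots> \<le> (1 / 2 * (mn - a * lam)\<^sup>2) / (2 * q2\<^sup>2)"
          by (intro divide_right_mono) (auto simp: m2_def)
        also have "\<dots> = (mn - a * lam)\<^sup>2 / (2 * q2)\<^sup>2"
          by (simp add: power_mult_distrib)
        finally have "g * (2 * q2) < mn - a * lam"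
          using \<open>a * lam < mn\<close> by (intro mult_less_if_square_less) auto
        also have "mn \<le> \<bar>beta_star $ j\<bar>"
          unfolding mn_def min_norm_on_def using that by (intro Min_le) auto
        finally show ?thesis by (simp add: q2 mult.commute)
      qed
      show "\<bar>logit_grad X (\<lambda>i. y i \<omega>) beta_star $ j\<bar> + (1 + 2 * Q3 X A beta_star) * g < a1 * lam"
        if "j \<notin> A" for j
      proof -
        have "G \<omega> j < t3" using \<omega> that by (auto simp: B_def not_le)
        moreover have "g * (2 * (1 + 2 * q3)) < a1 * lam"
        proof (cases "A = {}")
          case True
          then show ?thesis using \<open>0 < a1\<close> \<open>0 < lam\<close> by (simp add: g_def)
        next
          case False
          have "g\<^sup>2 < m1 / 2" using g_less[OF False _ t1(2)] \<omega> t1(1) by simp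
          also have "\<dots> \<le> (a1\<^sup>2 * lam\<^sup>2 / (2 * (1 + 2 * q3)\<^sup>2)) / 2"
            by (intro divide_right_mono) (auto simp: m1_def)
          also have "\<dots> = (a1 * lam)\<^sup>2 / (2 * (1 + 2 * q3))\<^sup>2"
            by (simp only: power_mult_distrib) simp
          finally show ?thesis
            using \<open>0 < a1\<close> \<open>0 < lam\<close> by (intro mult_less_if_square_less) auto
        qed
        ultimately show ?thesis
          by (simp add: G_def t3_def q3 algebra_simps)
      qed
    qed
    then show "\<omega> \<in> L" using \<omega> by (simp add: L_def)
  qed
  then have "prob (space Pr - (B0 \<union> B t1 A \<union> B t2 A \<union> B t3 (- A))) \<le> prob L"
    using L by (rule finite_measure_mono)
  moreover have "prob (space Pr - (B0 \<union> B t1 A \<union> B t2 A \<union> B t3 (- A))) =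
      1 - prob (B0 \<union> B t1 A \<union> B t2 A \<union> B t3 (- A))"
    using B0 B(1) t1(2) t2(2) \<open>0 \<le> t3\<close> by (intro prob_compl) auto
  moreover have "prob (B0 \<union> B t1 A \<union> B t2 A \<union> B t3 (- A)) \<le>
      prob B0 + prob (B t1 A) + prob (B t2 A) + prob (B t3 (- A))"
    using B0 B(1) t1(2) t2(2) \<open>0 \<le> t3\<close>
    by (intro order_trans[OF measure_Un_le] add_mono order_refl) auto
  \<comment> \<open>\<open>delta1\<close> pays for the thresholds \<open>t1\<close> on
    \<open>A\<close> and \<open>t3\<close> off \<open>A\<close>, and \<open>delta2\<close> for
    \<open>t2\<close> on \<open>A\<close>.\<close>
  moreover have "prob (B t1 A) + prob (B t3 (- A)) \<le> delta1"
  proof -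
    have "prob (B t1 A) \<le> 2 * s * exp (- (n / M) * m1)"
      using B(2)[OF t1(2), of A] by (simp add: t1(1) s)
    moreover have "real (card (- A)) = p - s"
      by (simp add: Compl_eq_Diff_UNIV card_Diff_subset p_def s of_nat_diff card_mono)
    then have "prob (B t3 (- A)) \<le> 2 * (p - s) * exp (- (a1\<^sup>2 * n * lam\<^sup>2 / (2 * M)))"
      using B(2)[OF \<open>0 \<le> t3\<close>, of "- A"] by (simp add: t3_def power_divide power_mult_distrib mult_ac)
    ultimately show ?thesis
      unfolding delta1_def m1_def by (rule add_mono)
  qed
  moreover have "prob (B t2 A) \<le> delta2"
    using B(2)[OF t2(2), of A] unfolding t2(1) delta2_def m2_def[unfolded mn_def, symmetric]
    by (simp add: s)
  moreover have "prob B0 = delta0"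
    by (simp add: B0_def delta0_def)
  ultimately show ?thesis
    unfolding L_def[symmetric] by linarith
qed

end
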